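(* Let $G$ be a finite simple graph, let $\pi=\{W_1,\ldots,W_r\}$ be a clique partition of $G$ with $W_a=\{x_{a,1},\ldots,x_{a,|W_a|}\}$, and let $G^{\pi}$ be the clique-whiskered graph of $G$ with respect to $\pi$, with whisker vertices $w_1,\ldots,w_r$. Let $S=\Bbbk[V(G^\pi)]$ be the polynomial ring over a field $\Bbbk$ whose variables are the vertices of $G^\pi$. Order $V(G)$ by $$x_{1,1}<\cdots<x_{1,|W_1|}<x_{2,1}<\cdots<x_{2,|W_2|}<\cdots<x_{r,1}<\cdots<x_{r,|W_r|}.$$ For $p\ge 0$ let $F_p$ be the free $S$-module with basis the symbols $\mathbf{f}(C;\sigma)$ of multidegree $\mathbf{z}_C\mathbf{x}_\sigma$, where $C$ runs over the minimal vertex covers of $G^\pi$ and $\sigma$ runs over the subsets of $V(G)\setminus C$ with $|\sigma|=p$. Let $d_0:F_0\to J(G^\pi)$ be given by $d_0(\mathbf{f}(C;\emptyset))=\mathbf{z}_C$, and for $p>0$ let $d_p:F_p\to F_{p-1}$ be given by $$d_p(\mathbf{f}(C;\sigma))=\sum_{x_{a,b}\in\sigma}(-1)^{\alpha(\sigma;x_{a,b})}\Big[w_a\,\mathbf{f}\big((C\setminus\{w_a\})\cup\{x_{a,b}\};\sigma\setminus\{x_{a,b}\}\big)-x_{a,b}\,\mathbf{f}\big(C;\sigma\setminus\{x_{a,b}\}\big)\Big],$$ where $\alpha(\sigma;x_{a,b})=|\{x_{s,t}\in\sigma : x_{s,t}>x_{a,b}\}|$. Then $$\mathbb{F}:\cdots\to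 F_p\xrightarrow{d_p}F_{p-1}\to\cdots\xrightarrow{d_1}F_0\xrightarrow{d_0}J(G^\pi)\to 0$$ is a minimal free resolution of the cover ideal $J(G^\pi)$.
   Context: Graphs are finite simple graphs; $\Bbbk$ is an arbitrary field. A clique of $G$ is a set of vertices inducing a complete graph. A clique partition $\pi=\{W_1,\ldots,W_r\}$ of $G$ is a family of cliques whose disjoint union is $V(G)$. The clique-whiskered graph $G^\pi$ has vertex set $V(G)\cup\{w_1,\ldots,w_r\}$ (with $w_1,\dots,w_r$ new vertices) and edge set $E(G)\cup\bigcup_{a=1}^r\{\{x,w_a\}: x\in W_a\}$. A vertex cover of a graph is a set of vertices meeting every edge; it is minimal if it is minimal under inclusion. The cover ideal $J(\Gamma)$ of a graph $\Gamma$ is the ideal of $\Bbbk[V(\Gamma)]$ generated by the monomials $\prod_{v\in C}v$ for $C$ a vertex cover of $\Gamma$. For $C\subseteq V(G^\pi)$, $\mathbf{z}_C=\prod_{v\in C}v$; for $\sigma\subseteq V(G)$, $\mathbf{x}_\sigma=\prod_{x\in\sigma}x$. *)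

theory Defs
  imports
    "Jordan_Normal_Form.Missing_VectorSpace"
    "HOL-Algebra.Ideal"
    "HOL-Library.Poly_Mapping"
begin

section \<open>Graphs, clique partitions and clique-whiskered graphs\<close>

definition simple_graph :: "'v set \<Rightarrow> 'v set set \<Rightarrow> bool" where
  "simple_graph V E \<longleftrightarrow>
     finite V \<and> (\<forall>e\<in>E. \<exists>u\<in>V. \<exists>v\<in>V. u \<noteq> v \<and> e = {u, v})"

definition clique :: "'v set \<Rightarrow> 'v set set \<Rightarrow> 'v set \<Rightarrow> bool" where
  "clique V E W \<longleftrightarrow> W \<subseteq> V \<and> (\<forall>u\<in>W. \<forall>v\<in>W. u \<noteq> v \<longrightarrow> {u, v} \<in> E)"

text \<open>
  A clique partition is given together with the enumeration of each of its cliques: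
  \<open>Ws ! a ! b\<close> is the vertex $x_{a+1,b+1}$ (list positions start at 0).
  Distinctness of the concatenation says that every block is enumerated without repetition and
  that the blocks are pairwise disjoint.  Empty blocks are allowed.
\<close>

definition clique_partition :: "'v set \<Rightarrow> 'v set set \<Rightarrow> 'v list list \<Rightarrow> bool" where
  "clique_partition V E Ws \<longleftrightarrow>
     distinct (concat Ws) \<and> (\<Union>W\<in>set Ws. set W) = V \<and> (\<forall>W\<in>set Ws. clique V E (set W))"

definition block_of :: "'v list list \<Rightarrow> 'v \<Rightarrow> nat" where
  "block_of Ws x = (THE a. a < length Ws \<and> x \<in> set (Ws ! a))"

definition vertex_less :: "'v list list \<Rightarrow> 'v \<Rightarrow> 'v \<Rightarrow> bool" where
  "vertex_less Ws x y \<longleftrightarrow>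
     (\<exists>a b s t. a < length Ws \<and> b < length (Ws ! a) \<and> x = Ws ! a ! b \<and>
                s < length Ws \<and> t < length (Ws ! s) \<and> y = Ws ! s ! t \<and>
                (a < s \<or> a = s \<and> b < t))"

text \<open>The vertices of the whiskered graph: \<open>Inl x\<close> for $x \in V(G)$, and \<open>Inr a\<close> for $w_{a+1}$.\<close>

definition whiskered_vertices :: "'v set \<Rightarrow> 'v list list \<Rightarrow> ('v + nat) set" where
  "whiskered_vertices V Ws = Inl ` V \<union> Inr ` {..<length Ws}"

definition whiskered_edges :: "'v set set \<Rightarrow> 'v list list \<Rightarrow> ('v + nat) set set" where
  "whiskered_edges E Ws =
     (\<lambda>e. Inl ` e) ` E \<union> (\<Union>a<length Ws. {{Inl x, Inr a} | x. x \<in> set (Ws ! a)})"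

definition vertex_cover :: "'v set \<Rightarrow> 'v set set \<Rightarrow> 'v set \<Rightarrow> bool" where
  "vertex_cover V E C \<longleftrightarrow> C \<subseteq> V \<and> (\<forall>e\<in>E. e \<inter> C \<noteq> {})"

definition minimal_vertex_cover :: "'v set \<Rightarrow> 'v set set \<Rightarrow> 'v set \<Rightarrow> bool" where
  "minimal_vertex_cover V E C \<longleftrightarrow>
     vertex_cover V E C \<and> (\<forall>C'. vertex_cover V E C' \<and> C' \<subseteq> C \<longrightarrow> C' = C)"


section \<open>Polynomial rings and cover ideals\<close>

text \<open>
  A monomial, equivalently a multidegree, is an exponent vector \<open>'v \<Rightarrow>\<^sub>0 nat\<close>.  The ring \<open>poly_ring V\<close> is
  the polynomial ring whose variables are exactly the elements of \<open>V\<close>, as a subring of the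
  polynomials in variables from all of \<open>'v\<close>.
\<close>

type_synonym ('v, 'k) mpoly = "('v \<Rightarrow>\<^sub>0 nat) \<Rightarrow>\<^sub>0 'k"

definition Var :: "'v \<Rightarrow> ('v, 'k::field) mpoly" where
  "Var v = Poly_Mapping.single (Poly_Mapping.single v 1) 1"

definition poly_ring :: "'v set \<Rightarrow> ('v, 'k::field) mpoly ring" where
  "poly_ring V =
     \<lparr>carrier = {f. \<forall>t\<in>Poly_Mapping.keys f. Poly_Mapping.keys t \<subseteq> V},
      mult = (*), one = 1, zero = 0, add = (+)\<rparr>"

definition monom_of :: "'v set \<Rightarrow> ('v, 'k::field) mpoly" where
  "monom_of C = (\<Prod>v\<in>C. Var v)"

definition mdeg_of :: "'v set \<Rightarrow> ('v \<Rightarrow>\<^sub>0 nat)" where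
  "mdeg_of C = (\<Sum>v\<in>C. Poly_Mapping.single v 1)"

definition graded_maximal_ideal :: "'v set \<Rightarrow> ('v, 'k::field) mpoly set" where
  "graded_maximal_ideal V = Idl\<^bsub>poly_ring V\<^esub> (Var ` V)"

definition cover_ideal :: "'v set \<Rightarrow> 'v set set \<Rightarrow> ('v, 'k::field) mpoly set" where
  "cover_ideal V E = Idl\<^bsub>poly_ring V\<^esub> {monom_of C | C. vertex_cover V E C}"

definition ideal_module :: "('a, 'm) ring_scheme \<Rightarrow> 'a set \<Rightarrow> ('a, 'a) module" where
  "ideal_module R I =
     \<lparr>carrier = I, mult = mult R, one = one R, zero = zero R, add = add R, smult = mult R\<rparr>"


section \<open>Minimal free resolutions\<close>

definition free_module :: "('a, 'm) ring_scheme \<Rightarrow> ('a, 'b, 'n) module_scheme \<Rightarrow> bool" where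
  "free_module R M \<longleftrightarrow>
     Module.module R M \<and>
     (\<exists>B \<subseteq> carrier M. \<not> module.lin_dep R M B \<and> module.span R M B = carrier M)"

text \<open>
  The complex $\cdots \to F_1 \to F_0 \to M \to 0$ has differentials
  \<open>d p : F p \<rightarrow> F (p - 1)\<close> for $p > 0$ and augmentation \<open>d0 : F 0 \<rightarrow> M\<close>; the value \<open>d 0\<close> is not used.
\<close>

definition free_resolution ::
  "('a, 'm) ring_scheme \<Rightarrow> ('a, 'c, 'n) module_scheme \<Rightarrow> (nat \<Rightarrow> ('a, 'b, 'o) module_scheme) \<Rightarrow>
   (nat \<Rightarrow> 'b \<Rightarrow> 'b) \<Rightarrow> ('b \<Rightarrow> 'c) \<Rightarrow> bool" where
  "free_resolution R M F d d0 \<longleftrightarrow>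
     (\<forall>p. free_module R (F p)) \<and>
     (\<forall>p. mod_hom R (F (Suc p)) (F p) (d (Suc p))) \<and>
     mod_hom R (F 0) M d0 \<and>
     mod_hom.im (F 0) d0 = carrier M \<and>
     mod_hom.im (F 1) (d 1) = mod_hom.ker (F 0) M d0 \<and>
     (\<forall>p. mod_hom.im (F (Suc (Suc p))) (d (Suc (Suc p)))
            = mod_hom.ker (F (Suc p)) (F p) (d (Suc p)))"

definition ideal_smult :: "('a, 'm) ring_scheme \<Rightarrow> 'a set \<Rightarrow> ('a, 'b, 'n) module_scheme \<Rightarrow> 'b set" where
  "ideal_smult R I M = module.span R M {a \<odot>\<^bsub>M\<^esub> x | a x. a \<in> I \<and> x \<in> carrier M}"

text \<open>Minimality is relative to an ideal \<open>I\<close>; for graded modules over a polynomial ring, \<open>I\<close> is the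
  ideal generated by the variables.\<close>

definition minimal_free_resolution ::
  "('a, 'm) ring_scheme \<Rightarrow> 'a set \<Rightarrow> ('a, 'c, 'n) module_scheme \<Rightarrow>
   (nat \<Rightarrow> ('a, 'b, 'o) module_scheme) \<Rightarrow> (nat \<Rightarrow> 'b \<Rightarrow> 'b) \<Rightarrow> ('b \<Rightarrow> 'c) \<Rightarrow> bool" where
  "minimal_free_resolution R I M F d d0 \<longleftrightarrow>
     free_resolution R M F d d0 \<and>
     (\<forall>p. mod_hom.im (F (Suc p)) (d (Suc p)) \<subseteq> ideal_smult R I (F p))"


section \<open>Multigraded free modules on a set of symbols\<close>

text \<open>An element is a finitely supported family of coefficients; \<open>Poly_Mapping.single b 1\<close> is the
  basis element belonging to the symbol \<open>b\<close>.  The fields \<open>mult\<close> and \<open>one\<close> are dummies.\<close>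

definition scale :: "'s::comm_ring_1 \<Rightarrow> ('b \<Rightarrow>\<^sub>0 's) \<Rightarrow> ('b \<Rightarrow>\<^sub>0 's)" where
  "scale c \<phi> = Poly_Mapping.map ((*) c) \<phi>"

definition free_module_on ::
  "'v set \<Rightarrow> 'b set \<Rightarrow> (('v, 'k::field) mpoly, 'b \<Rightarrow>\<^sub>0 ('v, 'k) mpoly) module" where
  "free_module_on V B =
     \<lparr>carrier = {\<phi>. Poly_Mapping.keys \<phi> \<subseteq> B \<and>
                    (\<forall>b. Poly_Mapping.lookup \<phi> b \<in> carrier (poly_ring V))},
      mult = (\<lambda>_ _. 0), one = 0, zero = 0, add = (+), smult = scale\<rparr>"

definition free_module_component ::
  "'v set \<Rightarrow> 'b set \<Rightarrow> ('b \<Rightarrow> ('v \<Rightarrow>\<^sub>0 nat)) \<Rightarrow> ('v \<Rightarrow>\<^sub>0 nat) \<Rightarrow> ('b \<Rightarrow>\<^sub>0 ('v, 'k::field) mpoly) set" where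
  "free_module_component V B deg \<mu> =
     {\<phi> \<in> carrier (free_module_on V B).
        \<forall>b\<in>Poly_Mapping.keys \<phi>. \<forall>t\<in>Poly_Mapping.keys (Poly_Mapping.lookup \<phi> b). t + deg b = \<mu>}"

definition ideal_component ::
  "('v, 'k::field) mpoly set \<Rightarrow> ('v \<Rightarrow>\<^sub>0 nat) \<Rightarrow> ('v, 'k) mpoly set" where
  "ideal_component J \<mu> = {f \<in> J. Poly_Mapping.keys f \<subseteq> {\<mu>}}"

definition homogeneous_map :: "('d \<Rightarrow> 'b set) \<Rightarrow> ('d \<Rightarrow> 'c set) \<Rightarrow> ('b \<Rightarrow> 'c) \<Rightarrow> bool" where
  "homogeneous_map M N f \<longleftrightarrow> (\<forall>\<mu>. f ` M \<mu> \<subseteq> N \<mu>)"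


section \<open>The complex of a clique-whiskered graph\<close>

text \<open>The pair \<open>(C, \<sigma>)\<close> stands for the symbol $\mathbf f(C;\sigma)$.\<close>

type_synonym 'v symb = "('v + nat) set \<times> 'v set"

definition symbols :: "'v set \<Rightarrow> 'v set set \<Rightarrow> 'v list list \<Rightarrow> nat \<Rightarrow> 'v symb set" where
  "symbols V E Ws p =
     {(C, \<sigma>). minimal_vertex_cover (whiskered_vertices V Ws) (whiskered_edges E Ws) C \<and>
              \<sigma> \<subseteq> {x \<in> V. Inl x \<notin> C} \<and> card \<sigma> = p}"

definition symbol_mdeg :: "'v symb \<Rightarrow> ('v + nat \<Rightarrow>\<^sub>0 nat)" where
  "symbol_mdeg = (\<lambda>(C, \<sigma>). mdeg_of C + mdeg_of (Inl ` \<sigma>))"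

definition resolution_module ::
  "'v set \<Rightarrow> 'v set set \<Rightarrow> 'v list list \<Rightarrow> nat \<Rightarrow>
   (('v + nat, 'k::field) mpoly, 'v symb \<Rightarrow>\<^sub>0 ('v + nat, 'k) mpoly) module" where
  "resolution_module V E Ws p = free_module_on (whiskered_vertices V Ws) (symbols V E Ws p)"

definition resolution_component ::
  "'v set \<Rightarrow> 'v set set \<Rightarrow> 'v list list \<Rightarrow> nat \<Rightarrow>
   ('v + nat \<Rightarrow>\<^sub>0 nat) \<Rightarrow> ('v symb \<Rightarrow>\<^sub>0 ('v + nat, 'k::field) mpoly) set" where
  "resolution_component V E Ws p =
     free_module_component (whiskered_vertices V Ws) (symbols V E Ws p) symbol_mdeg"

definition symb :: "('v + nat) set \<Rightarrow> 'v set \<Rightarrow> ('v symb \<Rightarrow>\<^sub>0 ('v + nat, 'k::field) mpoly)" where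
  "symb C \<sigma> = Poly_Mapping.single (C, \<sigma>) 1"

definition alpha :: "'v list list \<Rightarrow> 'v set \<Rightarrow> 'v \<Rightarrow> nat" where
  "alpha Ws \<sigma> x = card {y \<in> \<sigma>. vertex_less Ws x y}"

definition symbol_boundary ::
  "'v list list \<Rightarrow> 'v symb \<Rightarrow> ('v symb \<Rightarrow>\<^sub>0 ('v + nat, 'k::field) mpoly)" where
  "symbol_boundary Ws = (\<lambda>(C, \<sigma>).
     \<Sum>x\<in>\<sigma>. let w = Inr (block_of Ws x) in
       scale ((-1) ^ alpha Ws \<sigma> x)
         (scale (Var w) (symb ((C - {w}) \<union> {Inl x}) (\<sigma> - {x})) -
          scale (Var (Inl x)) (symb C (\<sigma> - {x}))))"

text \<open>The differentials $d_p$, $p > 0$, are all given by the same formula; $d_p$ is the restriction of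
  \<open>boundary\<close> to $F_p$.\<close>

definition boundary ::
  "'v list list \<Rightarrow> ('v symb \<Rightarrow>\<^sub>0 ('v + nat, 'k::field) mpoly) \<Rightarrow>
   ('v symb \<Rightarrow>\<^sub>0 ('v + nat, 'k) mpoly)" where
  "boundary Ws \<phi> =
     (\<Sum>s\<in>Poly_Mapping.keys \<phi>. scale (Poly_Mapping.lookup \<phi> s) (symbol_boundary Ws s))"

definition augmentation ::
  "('v symb \<Rightarrow>\<^sub>0 ('v + nat, 'k::field) mpoly) \<Rightarrow> ('v + nat, 'k) mpoly" where
  "augmentation \<phi> = (\<Sum>(C, \<sigma>)\<in>Poly_Mapping.keys \<phi>. Poly_Mapping.lookup \<phi> (C, \<sigma>) * monom_of C)"

end

theory Submission
  imports Defs
begin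

text \<open>
  Whiskering turns minimal vertex covers into independent sets: each block \<open>W\<^sub>a \<union> {w\<^sub>a}\<close> is a clique, so
  a cover omits at most one of its vertices, and a minimal cover contains \<open>w\<^sub>a\<close> exactly when it
  omits a vertex of \<open>W\<^sub>a\<close>.  Hence the minimal covers of the whiskered graph are the sets \<open>cov I\<close> with
  \<open>I \<subseteq> V\<close> independent in \<open>G\<close> (\<open>minimal_vertex_cover_iff\<close>), and the symbols \<open>(cov I, \<sigma>)\<close>,
  \<open>\<sigma> \<subseteq> I\<close>, are the intervals \<open>[I - \<sigma>, I]\<close> of the independence complex, seen as cubes.  The boundary
  map is the homogenised cubical boundary: the face of \<open>(I, \<sigma>)\<close> in direction \<open>x\<close> is
  \<open>w (I - {x}, \<sigma> - {x}) - x (I, \<sigma> - {x})\<close> with \<open>w\<close> the whisker of the block of \<open>x\<close>.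

  Both summands of a face carry a variable as coefficient, so the complex is minimal, and both have the
  degree of \<open>(I, \<sigma>)\<close>, because \<open>w z\<^bsub>cov (I - {x})\<^esub> = x z\<^bsub>cov I\<^esub>\<close> (\<open>mdeg_of_cov_remove\<close>).  The boundary of
  a boundary vanishes since exchanging two directions changes the sign (\<open>eps_swap\<close>).

  Exactness: in a fixed degree the cubes, if there are any, form a cone, which is contracted towards a
  single vertex.
  Call a vertex \<open>x\<close> active in the term \<open>t (I, \<sigma>)\<close>, where \<open>t\<close> is a monomial, if \<open>x \<in> \<sigma>\<close>, or \<open>x \<in> I\<close> and \<open>x\<close>
  divides \<open>t\<close>.  Let \<open>m\<close> be the largest active vertex.  The homotopy sends the term to
  \<open>- (t / m) (I, \<sigma> \<union> {m})\<close> if \<open>m \<notin> \<sigma>\<close>, and to \<open>0\<close> if \<open>m \<in> \<sigma>\<close>.  With \<open>d\<close> the boundary and \<open>h\<close> the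
  homotopy, \<open>1 - d h - h d\<close> does not vanish, but it strictly decreases the number of active vertices of
  every term that has one (\<open>homotopy_identity_not_in\<close>, \<open>homotopy_identity_in\<close>, \<open>residual_mterm\<close>).
  Iterating, every cycle (in degree \<open>0\<close>, every element) is homologous to a cycle whose terms have no active vertex.  In positive
  homological degree there are no such terms; in degree \<open>0\<close> such a term is determined by its multidegree
  \<open>\<mu>\<close>, since \<open>I\<close> is then the set of vertices of \<open>G\<close> not dividing \<open>\<mu>\<close>, so the augmentation is injective
  on combinations of such terms (\<open>augmentation_inactive_inj\<close>).
\<close>

section \<open>Additive maps on finitely supported families\<close>

text \<open>The map that is \<open>g s\<close> on the coefficient at \<open>s\<close>, summed over all \<open>s\<close>.  It is of interest for
  additive \<open>g s\<close> only, and then it is additive.  The coefficients may be polynomials or scalars.\<close>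

definition additive_ext :: "('b \<Rightarrow> 'r \<Rightarrow> 'm) \<Rightarrow> ('b \<Rightarrow>\<^sub>0 'r::zero) \<Rightarrow> 'm::comm_monoid_add" where
  "additive_ext g \<phi> = (\<Sum>s\<in>Poly_Mapping.keys \<phi>. g s (Poly_Mapping.lookup \<phi> s))"

lemma additive_ext_superset:
  assumes "\<And>s. g s 0 = 0" "finite A" "Poly_Mapping.keys \<phi> \<subseteq> A"
  shows "additive_ext g \<phi> = (\<Sum>s\<in>A. g s (Poly_Mapping.lookup \<phi> s))"
  unfolding additive_ext_def
  by (rule sum.mono_neutral_left) (use assms in \<open>auto simp: in_keys_iff\<close>)

lemma additive_ext_zero [simp]: "additive_ext g 0 = 0"
  by (simp add: additive_ext_def)

lemma additive_ext_add:
  assumes "\<And>s. g s 0 = 0" "\<And>s a b. g s (a + b) = g s a + g s b"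
  shows "additive_ext g (\<phi> + \<psi>) = additive_ext g \<phi> + additive_ext g (\<psi> :: 'b \<Rightarrow>\<^sub>0 'r::comm_monoid_add)"
proof -
  let ?A = "Poly_Mapping.keys \<phi> \<union> Poly_Mapping.keys \<psi>"
  have "additive_ext g (\<phi> + \<psi>) = (\<Sum>s\<in>?A. g s (Poly_Mapping.lookup (\<phi> + \<psi>) s))"
    by (rule additive_ext_superset) (use assms keys_add[of \<phi> \<psi>] in auto)
  also have "\<dots> = (\<Sum>s\<in>?A. g s (Poly_Mapping.lookup \<phi> s)) + (\<Sum>s\<in>?A. g s (Poly_Mapping.lookup \<psi> s))"
    by (simp add: lookup_add assms sum.distrib)
  also have "\<dots> = additive_ext g \<phi> + additive_ext g \<psi>"
    by (subst (1 2) additive_ext_superset[of g ?A]) (use assms in auto)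
  finally show ?thesis .
qed

lemma additive_ext_single:
  assumes "g s 0 = 0"
  shows "additive_ext g (Poly_Mapping.single s a) = g s a"
  by (cases "a = 0") (simp_all add: additive_ext_def assms)

lemma additive_zero:
  assumes "\<And>a b :: 'a::ab_group_add. f (a + b) = f a + (f b :: 'b::ab_group_add)"
  shows "f 0 = 0"
  by (metis add_cancel_right_right assms)

lemma additive_uminus:
  assumes "\<And>a b :: 'a::ab_group_add. f (a + b) = f a + (f b :: 'b::ab_group_add)"
  shows "f (- a) = - f a"
  by (metis add.right_inverse add_eq_0_iff additive_zero assms)

lemma additive_diff:
  assumes "\<And>a b :: 'a::ab_group_add. f (a + b) = f a + (f b :: 'b::ab_group_add)"
  shows "f (a - b) = f a - f b"
  by (metis add_diff_cancel assms diff_add_cancel)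

lemma additive_sum:
  assumes "\<And>a b :: 'a::ab_group_add. f (a + b) = f a + (f b :: 'b::ab_group_add)"
  shows "f (sum h A) = (\<Sum>a\<in>A. f (h a))"
  by (induction A rule: infinite_finite_induct) (simp_all add: assms additive_zero[of f])

text \<open>Opposite pairs are cancelled one by one: that the sum equals its negative would not suffice in
  characteristic \<open>2\<close>.\<close>

lemma sum_antisymmetric_eq_0:
  fixes f :: "'a \<Rightarrow> 'a \<Rightarrow> 'b::ab_group_add"
  assumes "finite A" "\<And>x y. x \<in> A \<Longrightarrow> y \<in> A \<Longrightarrow> x \<noteq> y \<Longrightarrow> f x y + f y x = 0"
  shows "(\<Sum>x\<in>A. \<Sum>y\<in>A - {x}. f x y) = 0"
  using assms
proof (induction A rule: finite_induct)
  case empty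
  then show ?case by simp
next
  case (insert a A)
  have "(\<Sum>y\<in>insert a A - {x}. f x y) = f x a + (\<Sum>y\<in>A - {x}. f x y)" if "x \<in> A" for x
  proof -
    have "insert a A - {x} = insert a (A - {x})" using that insert.hyps by auto
    then show ?thesis using insert.hyps by simp
  qed
  then have "(\<Sum>x\<in>insert a A. \<Sum>y\<in>insert a A - {x}. f x y) =
      (\<Sum>y\<in>A. f a y) + (\<Sum>x\<in>A. f x a + (\<Sum>y\<in>A - {x}. f x y))"
    using insert.hyps by simp
  also have "\<dots> = (\<Sum>y\<in>A. f a y + f y a) + (\<Sum>x\<in>A. \<Sum>y\<in>A - {x}. f x y)"
    by (simp add: sum.distrib add.assoc)
  also have "\<dots> = 0"
  proof -
    have "(\<Sum>y\<in>A. f a y + f y a) = 0"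
      by (rule sum.neutral) (use insert in auto)
    moreover have "(\<Sum>x\<in>A. \<Sum>y\<in>A - {x}. f x y) = 0"
      by (rule insert.IH) (use insert.prems in auto)
    ultimately show ?thesis by simp
  qed
  finally show ?case .
qed

section \<open>Elements built from monomial terms\<close>

text \<open>The element \<open>c t \<cdot> s\<close> of a free module: a scalar \<open>c\<close> times a monomial \<open>t\<close> times the basis
  symbol \<open>s\<close>.\<close>

definition mterm :: "'b \<Rightarrow> ('v \<Rightarrow>\<^sub>0 nat) \<Rightarrow> 'k::field \<Rightarrow> ('b \<Rightarrow>\<^sub>0 ('v, 'k) mpoly)" where
  "mterm s t c = Poly_Mapping.single s (Poly_Mapping.single t c)"

text \<open>The elements all of whose monomial terms \<open>t \<cdot> s\<close> satisfy \<open>P s t\<close>.  The free modules, their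
  graded components and the filtration used for exactness are all of this form.\<close>

definition supported :: "('b \<Rightarrow> ('v \<Rightarrow>\<^sub>0 nat) \<Rightarrow> bool) \<Rightarrow> ('b \<Rightarrow>\<^sub>0 ('v, 'k::field) mpoly) set" where
  "supported P = {\<phi>. \<forall>s\<in>Poly_Mapping.keys \<phi>. \<forall>t\<in>Poly_Mapping.keys (Poly_Mapping.lookup \<phi> s). P s t}"

lemma supported_iff_coeff:
  "\<phi> \<in> supported P \<longleftrightarrow> (\<forall>s t. Poly_Mapping.lookup (Poly_Mapping.lookup \<phi> s) t \<noteq> 0 \<longrightarrow> P s t)"
proof -
  have "s \<in> Poly_Mapping.keys \<phi>" if "Poly_Mapping.lookup (Poly_Mapping.lookup \<phi> s) t \<noteq> 0" for s t
    using that by (auto simp: in_keys_iff)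
  then show ?thesis
    unfolding supported_def by (auto simp: in_keys_iff)
qed

lemma mterm_zero [simp]: "mterm s t 0 = 0"
  by (simp add: mterm_def)

lemma mterm_add: "mterm s t (a + b) = mterm s t a + mterm s t b"
  by (simp add: mterm_def single_add)

lemma mterm_uminus: "mterm s t (- a) = - mterm s t a"
  by (simp add: mterm_def single_uminus)

lemma coeff_mterm:
  "Poly_Mapping.lookup (Poly_Mapping.lookup (mterm s t c) s') t' = (if s' = s \<and> t' = t then c else 0)"
  by (auto simp: mterm_def lookup_single when_def)

lemma supported_zero [simp]: "0 \<in> supported P"
  by (simp add: supported_def)

lemma supported_add: "\<phi> \<in> supported P \<Longrightarrow> \<psi> \<in> supported P \<Longrightarrow> \<phi> + \<psi> \<in> supported P"
  unfolding supported_iff_coeff lookup_add by (metis add.right_neutral)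

lemma supported_uminus: "\<phi> \<in> supported P \<Longrightarrow> - \<phi> \<in> supported P"
  by (simp add: supported_iff_coeff)

lemma supported_diff: "\<phi> \<in> supported P \<Longrightarrow> \<psi> \<in> supported P \<Longrightarrow> \<phi> - \<psi> \<in> supported P"
  using supported_add[OF _ supported_uminus, of \<phi> P \<psi>] by simp

lemma supported_sum: "(\<And>a. a \<in> A \<Longrightarrow> f a \<in> supported P) \<Longrightarrow> sum f A \<in> supported P"
  by (induction A rule: infinite_finite_induct) (auto intro: supported_add)

lemma supported_mterm: "P s t \<Longrightarrow> mterm s t c \<in> supported P"
  by (auto simp: supported_iff_coeff coeff_mterm split: if_splits)

lemma supported_mono: "\<phi> \<in> supported P \<Longrightarrow> (\<And>s t. P s t \<Longrightarrow> Q s t) \<Longrightarrow> \<phi> \<in> supported Q"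
  by (auto simp: supported_iff_coeff)

text \<open>Every element is the sum of its monomial terms.\<close>

lemma sum_single_keys: "(\<Sum>s\<in>Poly_Mapping.keys \<phi>. Poly_Mapping.single s (Poly_Mapping.lookup \<phi> s)) = \<phi>"
  by (rule poly_mapping_eqI) (simp add: lookup_sum lookup_single when_def in_keys_iff)

lemma single_eq_sum_mterm:
  "Poly_Mapping.single s f = (\<Sum>t\<in>Poly_Mapping.keys f. mterm s t (Poly_Mapping.lookup f t))"
proof -
  have "Poly_Mapping.single s f =
      Poly_Mapping.single s (\<Sum>t\<in>Poly_Mapping.keys f. Poly_Mapping.single t (Poly_Mapping.lookup f t))"
    by (simp only: sum_single_keys)
  also have "\<dots> = (\<Sum>t\<in>Poly_Mapping.keys f. mterm s t (Poly_Mapping.lookup f t))"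
    unfolding mterm_def by (rule additive_sum) (rule single_add)
  finally show ?thesis .
qed

lemma supported_induct [consumes 1, case_names zero add mterm]:
  assumes "\<phi> \<in> supported P"
    and zero: "R 0"
    and add: "\<And>a b. R a \<Longrightarrow> R b \<Longrightarrow> R (a + b)"
    and mterm: "\<And>s t c. P s t \<Longrightarrow> R (mterm s t c)"
  shows "R \<phi>"
proof -
  \<comment> \<open>used below at two index types: symbols and exponent vectors\<close>
  have sum: "R (sum f A)" if "\<And>a. a \<in> A \<Longrightarrow> R (f a)" for f and A :: "'z set"
    using that by (induction A rule: infinite_finite_induct) (auto intro: zero add)
  have "R (\<Sum>s\<in>Poly_Mapping.keys \<phi>. Poly_Mapping.single s (Poly_Mapping.lookup \<phi> s))"
    unfolding single_eq_sum_mterm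
    by (intro sum mterm) (use assms(1) in \<open>auto simp: supported_def\<close>)
  then show ?thesis by (simp only: sum_single_keys)
qed

section \<open>Polynomial rings and free modules\<close>

lemma lookup_scale: "Poly_Mapping.lookup (scale c \<phi>) b = c * Poly_Mapping.lookup \<phi> b"
  by (simp add: scale_def Poly_Mapping.map.rep_eq when_def)

lemma scale_add_right: "scale c (\<phi> + \<psi>) = scale c \<phi> + scale c \<psi>"
  by (rule poly_mapping_eqI) (simp add: lookup_scale lookup_add distrib_left)

lemma scale_add_left: "scale (c + d) \<phi> = scale c \<phi> + scale d \<phi>"
  by (rule poly_mapping_eqI) (simp add: lookup_scale lookup_add distrib_right)

lemma scale_scale: "scale c (scale d \<phi>) = scale (c * d) \<phi>"
  by (rule poly_mapping_eqI) (simp add: lookup_scale mult.assoc)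

lemma scale_one [simp]: "scale 1 \<phi> = \<phi>"
  by (rule poly_mapping_eqI) (simp add: lookup_scale)

lemma scale_zero_left [simp]: "scale 0 \<phi> = 0"
  by (rule poly_mapping_eqI) (simp add: lookup_scale)

lemma scale_zero_right [simp]: "scale c 0 = 0"
  by (rule poly_mapping_eqI) (simp add: lookup_scale)

lemma scale_diff_right: "scale c (\<phi> - \<psi>) = scale c \<phi> - scale c \<psi>"
  by (rule poly_mapping_eqI) (simp add: lookup_scale lookup_minus algebra_simps)

lemma scale_sum_right: "scale c (sum f A) = (\<Sum>a\<in>A. scale c (f a))"
  by (rule poly_mapping_eqI) (simp add: lookup_scale lookup_sum sum_distrib_left)

lemma scale_single: "scale c (Poly_Mapping.single b a) = Poly_Mapping.single b (c * a)"
  by (rule poly_mapping_eqI) (simp add: lookup_scale lookup_single when_def)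

lemma keys_scale: "Poly_Mapping.keys (scale c \<phi>) \<subseteq> Poly_Mapping.keys \<phi>"
  by (auto simp: in_keys_iff lookup_scale)

text \<open>Here \<open>h\<close> is multiplication by \<open>c\<close> on the codomain, so this is linearity of \<open>additive_ext g\<close>.\<close>

lemma additive_ext_scale:
  assumes "\<And>s. g s 0 = 0" "\<And>s a. g s (c * a) = h (g s a)"
    and "\<And>x y. h (x + y) = h x + h y" "h 0 = 0"
  shows "additive_ext g (scale c \<phi>) = h (additive_ext g \<phi>)"
proof -
  have h_sum: "h (sum f A) = (\<Sum>a\<in>A. h (f a))" for f and A :: "'z set"
    by (induction A rule: infinite_finite_induct) (simp_all add: assms)
  show ?thesis
    using additive_ext_superset[of g "Poly_Mapping.keys \<phi>" "scale c \<phi>"] keys_scale[of c \<phi>] assms(1,2)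
    by (simp add: lookup_scale additive_ext_def[of g \<phi>] h_sum)
qed

lemma scale_mterm: "scale (Poly_Mapping.single u a) (mterm s t c) = mterm s (u + t) (a * c)"
  by (simp add: mterm_def scale_single mult_single)

lemma keys_diff_nat: "Poly_Mapping.keys (t - u :: 'x \<Rightarrow>\<^sub>0 nat) \<subseteq> Poly_Mapping.keys t"
  by (auto simp: in_keys_iff lookup_minus)

text \<open>A variable that occurs in a monomial can be divided out.\<close>

lemma single_add_diff_cancel:
  fixes t :: "'x \<Rightarrow>\<^sub>0 nat"
  assumes "Poly_Mapping.lookup t v \<noteq> 0"
  shows "Poly_Mapping.single v 1 + (t - Poly_Mapping.single v 1) = t"
    and "u + t - Poly_Mapping.single v 1 = u + (t - Poly_Mapping.single v 1)"
  by (rule poly_mapping_eqI, use assms in \<open>auto simp: lookup_add lookup_minus lookup_single when_def\<close>)+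

lemma carrier_poly_ring_iff:
  "f \<in> carrier (poly_ring U) \<longleftrightarrow> (\<forall>t\<in>Poly_Mapping.keys f. Poly_Mapping.keys t \<subseteq> U)"
  by (simp add: poly_ring_def)

lemma poly_ring_sel [simp]:
  "mult (poly_ring U) = (*)" "one (poly_ring U) = 1" "zero (poly_ring U) = 0" "add (poly_ring U) = (+)"
  by (simp_all add: poly_ring_def)

lemma poly_ring_zero: "0 \<in> carrier (poly_ring U)"
  by (simp add: carrier_poly_ring_iff)

lemma poly_ring_one: "1 \<in> carrier (poly_ring U)"
  by (simp add: carrier_poly_ring_iff)

lemma poly_ring_uminus: "f \<in> carrier (poly_ring U) \<Longrightarrow> - f \<in> carrier (poly_ring U)"
  by (simp add: carrier_poly_ring_iff in_keys_iff)

lemma poly_ring_add: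
  "f \<in> carrier (poly_ring U) \<Longrightarrow> g \<in> carrier (poly_ring U) \<Longrightarrow> f + g \<in> carrier (poly_ring U)"
  using keys_add[of f g] unfolding carrier_poly_ring_iff by blast

lemma poly_ring_mult:
  assumes "f \<in> carrier (poly_ring U)" "g \<in> carrier (poly_ring U)"
  shows "f * g \<in> carrier (poly_ring U)"
  unfolding carrier_poly_ring_iff
proof
  fix t assume "t \<in> Poly_Mapping.keys (f * g)"
  then obtain a b where "t = a + b" "a \<in> Poly_Mapping.keys f" "b \<in> Poly_Mapping.keys g"
    using keys_mult[of f g] by auto
  then show "Poly_Mapping.keys t \<subseteq> U"
    using assms keys_add[of a b] unfolding carrier_poly_ring_iff by blast
qed

lemmas poly_ring_closed =
  poly_ring_zero poly_ring_one poly_ring_uminus poly_ring_add poly_ring_mult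

lemma cring_poly_ring: "cring (poly_ring U)" (is "cring ?R")
proof (rule cringI)
  show "abelian_group ?R"
  proof (rule abelian_groupI)
    fix f assume "f \<in> carrier ?R"
    then show "\<exists>g\<in>carrier ?R. g \<oplus>\<^bsub>?R\<^esub> f = \<zero>\<^bsub>?R\<^esub>"
      by (intro bexI[of _ "- f"]) (auto intro: poly_ring_closed)
  qed (auto simp: poly_ring_closed add.assoc add.commute)
  show "Group.comm_monoid ?R"
    by (rule comm_monoidI) (auto simp: poly_ring_closed mult.assoc mult.commute)
qed (auto simp: distrib_right)

lemma lookup_mdeg_of: "finite C \<Longrightarrow> Poly_Mapping.lookup (mdeg_of C) v = (if v \<in> C then 1 else 0)"
  unfolding mdeg_of_def by (simp add: lookup_sum lookup_single when_def)

lemma keys_mdeg_of: "finite C \<Longrightarrow> Poly_Mapping.keys (mdeg_of C) = C"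
  by (auto simp: in_keys_iff lookup_mdeg_of split: if_splits)

lemma mdeg_of_insert:
  "finite C \<Longrightarrow> v \<notin> C \<Longrightarrow> mdeg_of (insert v C) = Poly_Mapping.single v 1 + mdeg_of C"
  by (simp add: mdeg_of_def)

lemma monom_of_eq_single: "monom_of C = Poly_Mapping.single (mdeg_of C) 1"
  unfolding monom_of_def mdeg_of_def
  by (induction C rule: infinite_finite_induct) (simp_all add: Var_def mult_single)

lemma monom_of_closed: "finite C \<Longrightarrow> C \<subseteq> U \<Longrightarrow> monom_of C \<in> carrier (poly_ring U)"
  by (simp add: carrier_poly_ring_iff monom_of_eq_single keys_mdeg_of)

lemma Var_closed: "v \<in> U \<Longrightarrow> Var v \<in> carrier (poly_ring U)"
  by (simp add: carrier_poly_ring_iff Var_def)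

lemma carrier_free_module_on:
  "carrier (free_module_on U B) = supported (\<lambda>b t. b \<in> B \<and> Poly_Mapping.keys t \<subseteq> U)"
proof (rule Set.set_eqI)
  fix \<phi> :: "'a \<Rightarrow>\<^sub>0 ('b, 'c::field) mpoly"
  have "b \<in> Poly_Mapping.keys \<phi> \<Longrightarrow> \<exists>t. t \<in> Poly_Mapping.keys (Poly_Mapping.lookup \<phi> b)" for b
    by (metis keys_eq_empty in_keys_iff ex_in_conv)
  then have "\<phi> \<in> supported (\<lambda>b t. b \<in> B \<and> Poly_Mapping.keys t \<subseteq> U) \<longleftrightarrow>
      (\<forall>b\<in>Poly_Mapping.keys \<phi>. b \<in> B \<and> Poly_Mapping.lookup \<phi> b \<in> carrier (poly_ring U))"
    unfolding supported_def carrier_poly_ring_iff by blast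
  moreover have "b \<notin> Poly_Mapping.keys \<phi> \<Longrightarrow> Poly_Mapping.lookup \<phi> b \<in> carrier (poly_ring U)" for b
    by (simp add: in_keys_iff poly_ring_zero)
  ultimately show "\<phi> \<in> carrier (free_module_on U B) \<longleftrightarrow>
      \<phi> \<in> supported (\<lambda>b t. b \<in> B \<and> Poly_Mapping.keys t \<subseteq> U)"
    by (auto simp: free_module_on_def)
qed

lemma free_module_component_eq:
  "free_module_component U B deg \<mu> =
    supported (\<lambda>b t. b \<in> B \<and> Poly_Mapping.keys t \<subseteq> U \<and> t + deg b = \<mu>)"
  unfolding free_module_component_def carrier_free_module_on supported_def by auto

lemma free_module_on_sel [simp]:
  "zero (free_module_on U B) = 0" "add (free_module_on U B) = (+)" "smult (free_module_on U B) = scale"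
  by (simp_all add: free_module_on_def)

lemma scale_closed:
  assumes "c \<in> carrier (poly_ring U)" "\<phi> \<in> carrier (free_module_on U B)"
  shows "scale c \<phi> \<in> carrier (free_module_on U B)"
  using assms keys_scale[of c \<phi>] poly_ring_mult[of c U]
  by (auto simp: free_module_on_def lookup_scale)

lemma module_free_module_on: "Module.module (poly_ring U) (free_module_on U B)"
proof (rule module_criteria)
  show "cring (poly_ring U)" by (rule cring_poly_ring)
  show "\<forall>v\<in>carrier (free_module_on U B).
      \<exists>w\<in>carrier (free_module_on U B). v \<oplus>\<^bsub>free_module_on U B\<^esub> w = \<zero>\<^bsub>free_module_on U B\<^esub>"
    using supported_uminus by (force simp: carrier_free_module_on)
  show "\<zero>\<^bsub>free_module_on U B\<^esub> \<in> carrier (free_module_on U B)"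
    by (simp add: carrier_free_module_on)
  show "\<forall>v w. v \<in> carrier (free_module_on U B) \<and> w \<in> carrier (free_module_on U B) \<longrightarrow>
      v \<oplus>\<^bsub>free_module_on U B\<^esub> w \<in> carrier (free_module_on U B)"
    by (simp add: carrier_free_module_on supported_add)
qed (auto simp: scale_closed scale_scale scale_add_left scale_add_right add.assoc add.commute)

lemma finsum_free_module_on:
  assumes "f \<in> A \<rightarrow> carrier (free_module_on U B)"
  shows "(\<Oplus>\<^bsub>free_module_on U B\<^esub>a\<in>A. f a) = (\<Sum>a\<in>A. f a)"
proof -
  interpret Module.module "poly_ring U" "free_module_on U B" by (rule module_free_module_on)
  show ?thesis using assms
    by (induction A rule: infinite_finite_induct) (simp_all add: M.finsum_insert M.finsum_infinite)
qed

text \<open>The basis consists of the elements \<open>single b 1\<close>.\<close>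

lemma free_module_free_module_on:
  fixes U :: "'v set" and B :: "'b set"
  shows "free_module (poly_ring U :: ('v, 'k::field) mpoly ring) (free_module_on U B)"
proof -
  interpret M: Module.module "poly_ring U :: ('v, 'k) mpoly ring" "free_module_on U B" by (rule module_free_module_on)
  let ?e = "\<lambda>b. Poly_Mapping.single b (1 :: ('v, 'k) mpoly)"
  have inj: "inj_on ?e A" for A
    by (rule inj_onI) (metis keys_single one_neq_zero singleton_inject)
  have e: "?e b \<in> carrier (free_module_on U B)" if "b \<in> B" for b
    using that poly_ring_zero poly_ring_one by (auto simp: free_module_on_def lookup_single when_def)
  have lincomb: "M.lincomb a (?e ` A) = (\<Sum>b\<in>A. Poly_Mapping.single b (a (?e b)))"
    if "A \<subseteq> B" "a \<in> ?e ` A \<rightarrow> carrier (poly_ring U)" for a A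
  proof -
    have "M.lincomb a (?e ` A) = (\<Sum>v\<in>?e ` A. scale (a v) v)"
      unfolding M.lincomb_def free_module_on_sel
      by (rule finsum_free_module_on) (use that e scale_closed in blast)
    also have "\<dots> = (\<Sum>b\<in>A. Poly_Mapping.single b (a (?e b)))"
      by (simp add: sum.reindex inj scale_single)
    finally show ?thesis .
  qed
  have "\<not> M.lin_dep (?e ` B)"
  proof
    assume "M.lin_dep (?e ` B)"
    then obtain A a v where A: "finite A" "A \<subseteq> ?e ` B" "a \<in> A \<rightarrow> carrier (poly_ring U)"
      "M.lincomb a A = 0" "v \<in> A" "a v \<noteq> 0"
      unfolding M.lin_dep_def by auto
    then obtain A' where A': "A' \<subseteq> B" "A = ?e ` A'" by (auto simp: subset_image_iff)
    then obtain b where b: "b \<in> A'" "v = ?e b" using A by auto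
    have "finite A'" using A A' inj finite_imageD by blast
    then have "Poly_Mapping.lookup (\<Sum>b\<in>A'. Poly_Mapping.single b (a (?e b))) b = a v"
      using b by (simp add: lookup_sum lookup_single when_def)
    then show False using A A' lincomb[of A' a] by simp
  qed
  moreover have "M.span (?e ` B) = carrier (free_module_on U B)"
  proof
    show "M.span (?e ` B) \<subseteq> carrier (free_module_on U B)"
      by (rule M.span_is_subset2) (use e in auto)
    show "carrier (free_module_on U B) \<subseteq> M.span (?e ` B)"
    proof
      fix \<phi> :: "'b \<Rightarrow>\<^sub>0 ('v, 'k) mpoly"
      assume \<phi>: "\<phi> \<in> carrier (free_module_on U B)"
      define a where "a = (\<lambda>v. Poly_Mapping.lookup \<phi> (inv_into UNIV ?e v))"
      have a_e: "a (?e b) = Poly_Mapping.lookup \<phi> b" for b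
        unfolding a_def by (subst inv_into_f_f[OF inj]) simp_all
      have keys: "Poly_Mapping.keys \<phi> \<subseteq> B" and a: "a \<in> A \<rightarrow> carrier (poly_ring U)" for A
        using \<phi> by (auto simp: free_module_on_def a_def)
      have "M.lincomb a (?e ` Poly_Mapping.keys \<phi>) = \<phi>"
        using lincomb[OF keys a] by (simp add: a_e sum_single_keys)
      moreover have "finite (?e ` Poly_Mapping.keys \<phi>)" "?e ` Poly_Mapping.keys \<phi> \<subseteq> ?e ` B"
        using keys by auto
      ultimately show "\<phi> \<in> M.span (?e ` B)"
        unfolding M.span_def mem_Collect_eq using a by metis
    qed
  qed
  moreover have "?e ` B \<subseteq> carrier (free_module_on U B)" using e by auto
  ultimately show ?thesis
    unfolding free_module_def using M.module_axioms by blast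
qed

lemma ideal_module_module:
  assumes "ideal I (poly_ring U)"
  shows "Module.module (poly_ring U) (ideal_module (poly_ring U) I)" (is "Module.module ?R ?M")
proof -
  interpret ideal I ?R by (rule assms)
  have I: "f \<in> I \<Longrightarrow> f \<in> carrier ?R" for f using a_subset by blast
  have M: "carrier ?M = I" "zero ?M = 0" "add ?M = (+)" "smult ?M = (*)"
    by (simp_all add: ideal_module_def)
  have mult: "c \<in> carrier ?R \<Longrightarrow> f \<in> I \<Longrightarrow> c * f \<in> I" for c f
    using I_l_closed[of f c] by simp
  show ?thesis
  proof (rule module_criteria)
    show "cring ?R" by (rule cring_poly_ring)
    show "\<forall>v\<in>carrier ?M. \<exists>w\<in>carrier ?M. v \<oplus>\<^bsub>?M\<^esub> w = \<zero>\<^bsub>?M\<^esub>"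
      unfolding M
    proof
      fix f assume f: "f \<in> I"
      then have "(- 1) * f \<in> I"
        by (intro mult poly_ring_uminus poly_ring_one)
      then show "\<exists>w\<in>I. f + w = 0"
        by (intro bexI[of _ "- f"]) auto
    qed
    show "\<zero>\<^bsub>?M\<^esub> \<in> carrier ?M" using additive_subgroup.zero_closed[OF is_additive_subgroup] by (simp add: M)
    show "\<forall>v w. v \<in> carrier ?M \<and> w \<in> carrier ?M \<longrightarrow> v \<oplus>\<^bsub>?M\<^esub> w \<in> carrier ?M"
      using additive_subgroup.a_closed[OF is_additive_subgroup] by (simp add: M)
  qed (auto simp: M mult algebra_simps)
qed

section \<open>Minimal vertex covers and independent sets\<close>

text \<open>A finite simple graph with an enumerated clique partition.\<close>

locale clique_whiskering =
  fixes V :: "'v set" and E :: "'v set set" and Ws :: "'v list list"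
  assumes graph: "simple_graph V E" and partition: "clique_partition V E Ws"
begin

abbreviation "VW \<equiv> whiskered_vertices V Ws"
abbreviation "EW \<equiv> whiskered_edges E Ws"
abbreviation "bl \<equiv> block_of Ws"

lemma finite_V: "finite V"
  using graph by (simp add: simple_graph_def)

lemma finite_VW: "finite VW"
  using finite_V by (simp add: whiskered_vertices_def)

text \<open>A vertex has one position only, even though empty blocks may be repeated in the list.\<close>

lemma nth_nth_eqD:
  assumes "a < length Ws" "b < length (Ws ! a)" "s < length Ws" "t < length (Ws ! s)"
    and "Ws ! a ! b = Ws ! s ! t"
  shows "a = s \<and> b = t"
proof -
  have "distinct (concat Ws) \<Longrightarrow> ?thesis"
    using assms
  proof (induction Ws arbitrary: a s)
    case Nil
    then show ?case by simp
  next
    case (Cons W Ws)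
    have disj: "x \<in> set W \<Longrightarrow> c < length Ws \<Longrightarrow> x \<notin> set (Ws ! c)" for x c
      using Cons.prems(1) nth_mem by fastforce
    show ?case
    proof (cases a; cases s)
      assume "a = 0" "s = 0"
      then show ?thesis using Cons.prems by (simp add: nth_eq_iff_index_eq)
    next
      fix s' assume "a = 0" "s = Suc s'"
      then show ?thesis using Cons.prems disj[of "W ! b" s'] nth_mem[of b W] nth_mem[of t "Ws ! s'"] by simp
    next
      fix a' assume "a = Suc a'" "s = 0"
      then show ?thesis using Cons.prems disj[of "W ! t" a'] by (simp, metis nth_mem)
    next
      fix a' s' assume "a = Suc a'" "s = Suc s'"
      then show ?thesis using Cons.prems Cons.IH[of a' s'] by simp
    qed
  qed
  then show ?thesis using partition by (simp add: clique_partition_def)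
qed

lemma in_V_obtains:
  assumes "x \<in> V"
  obtains a b where "a < length Ws" "b < length (Ws ! a)" "x = Ws ! a ! b"
proof -
  obtain W where "W \<in> set Ws" "x \<in> set W" using assms partition by (auto simp: clique_partition_def)
  then show thesis using that by (metis in_set_conv_nth)
qed

lemma block_unique:
  assumes "a < length Ws" "x \<in> set (Ws ! a)"
  shows "bl x = a"
  unfolding block_of_def
  by (rule the_equality) (use assms nth_nth_eqD in \<open>auto simp: in_set_conv_nth\<close>)

lemma block: assumes "x \<in> V" shows "bl x < length Ws" "x \<in> set (Ws ! bl x)"
proof -
  obtain a b where "a < length Ws" "b < length (Ws ! a)" "x = Ws ! a ! b"
    using in_V_obtains assms by blast
  then show "bl x < length Ws" "x \<in> set (Ws ! bl x)" using block_unique[of a x] by auto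
qed

lemma block_subset: "a < length Ws \<Longrightarrow> set (Ws ! a) \<subseteq> V"
  using partition nth_mem by (fastforce simp: clique_partition_def)

lemma edge_in_block:
  assumes "x \<in> V" "y \<in> V" "bl x = bl y" "x \<noteq> y"
  shows "{x, y} \<in> E"
proof -
  have "Ws ! bl x \<in> set Ws" using block(1)[OF assms(1)] by simp
  then have "clique V E (set (Ws ! bl x))" using partition by (auto simp: clique_partition_def)
  then show ?thesis using assms block(2)[of x] block(2)[of y] by (auto simp: clique_def)
qed

lemma less_irrefl: "\<not> vertex_less Ws x x"
  unfolding vertex_less_def using nth_nth_eqD by fastforce

lemma less_trans: "vertex_less Ws x y \<Longrightarrow> vertex_less Ws y z \<Longrightarrow> vertex_less Ws x z"
proof -
  assume "vertex_less Ws x y" "vertex_less Ws y z"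
  then obtain a b s t s' t' c d where
    1: "a < length Ws" "b < length (Ws ! a)" "x = Ws ! a ! b"
       "s < length Ws" "t < length (Ws ! s)" "y = Ws ! s ! t" "a < s \<or> a = s \<and> b < t" and
    2: "s' < length Ws" "t' < length (Ws ! s')" "y = Ws ! s' ! t'"
       "c < length Ws" "d < length (Ws ! c)" "z = Ws ! c ! d" "s' < c \<or> s' = c \<and> t' < d"
    unfolding vertex_less_def by blast
  then have "s' = s" "t' = t" using nth_nth_eqD by metis+
  then have "a < c \<or> a = c \<and> b < d" using 1 2 by auto
  then show ?thesis unfolding vertex_less_def using 1 2 by blast
qed

lemma less_asym: "vertex_less Ws x y \<Longrightarrow> \<not> vertex_less Ws y x"
  using less_trans less_irrefl by blast

lemma less_total: "x \<in> V \<Longrightarrow> y \<in> V \<Longrightarrow> x \<noteq> y \<Longrightarrow> vertex_less Ws x y \<or> vertex_less Ws y x"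
  by (elim in_V_obtains) (unfold vertex_less_def, metis nat_neq_iff)

text \<open>\<open>vertex_less\<close> is a strict total order on \<open>V\<close>, so nonempty subsets have a largest element.\<close>

lemma exists_top:
  assumes "A \<subseteq> V" "A \<noteq> {}"
  shows "\<exists>m\<in>A. \<forall>y\<in>A - {m}. vertex_less Ws y m"
proof -
  have "finite A" using assms finite_V finite_subset by blast
  then show ?thesis using assms(2,1)
  proof (induction A rule: finite_ne_induct)
    case (singleton x)
    then show ?case by simp
  next
    case (insert x F)
    then obtain m where m: "m \<in> F" "\<forall>y\<in>F - {m}. vertex_less Ws y m" by auto
    show ?case
    proof (cases "vertex_less Ws x m")
      case True
      then show ?thesis using m by (intro bexI[of _ m]) auto
    next
      case False
      then have "vertex_less Ws m x" using less_total[of x m] insert m by blast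
      then show ?thesis using m less_trans by (intro bexI[of _ x]) blast+
    qed
  qed
qed

text \<open>Independent sets; \<open>u = v\<close> need not be excluded, because a simple graph has no loop \<open>{u, u}\<close>.\<close>

definition indep :: "'v set \<Rightarrow> bool" where
  "indep I \<longleftrightarrow> I \<subseteq> V \<and> (\<forall>u\<in>I. \<forall>v\<in>I. {u, v} \<notin> E)"

text \<open>The cover of the whiskered graph belonging to \<open>I\<close>: all vertices of \<open>G\<close> outside \<open>I\<close>, and the
  whiskers of the blocks that meet \<open>I\<close>.\<close>

definition cov :: "'v set \<Rightarrow> ('v + nat) set" where
  "cov I = Inl ` (V - I) \<union> Inr ` bl ` I"

lemma indep_subset: "indep I \<Longrightarrow> J \<subseteq> I \<Longrightarrow> indep J"
  unfolding indep_def by blast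

lemma indep_finite: "indep I \<Longrightarrow> finite I"
  using finite_V finite_subset unfolding indep_def by blast

lemma block_inj: "indep I \<Longrightarrow> inj_on bl I"
  using edge_in_block unfolding indep_def inj_on_def by blast

lemma Inl_in_cov: "Inl x \<in> cov I \<longleftrightarrow> x \<in> V \<and> x \<notin> I"
  unfolding cov_def by auto

lemma Inr_in_cov: "Inr a \<in> cov I \<longleftrightarrow> a \<in> bl ` I"
  unfolding cov_def by auto

lemma cov_subset: "indep I \<Longrightarrow> cov I \<subseteq> VW"
  unfolding cov_def whiskered_vertices_def indep_def using block(1) by auto

lemma finite_cov: "indep I \<Longrightarrow> finite (cov I)"
  using cov_subset finite_VW finite_subset by blast

text \<open>Exchanging the whisker of the block of \<open>x\<close> for \<open>x\<close>, as in the boundary map, removes \<open>x\<close> from \<open>I\<close>.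
  No other vertex of \<open>I\<close> needs that whisker, as \<open>I\<close> meets each block at most once.\<close>

lemma cov_remove:
  assumes "indep I" "x \<in> I"
  shows "cov (I - {x}) = cov I - {Inr (bl x)} \<union> {Inl x}"
proof -
  have "bl ` (I - {x}) = bl ` I - {bl x}"
    using block_inj[OF assms(1)] assms(2) by (auto simp: inj_on_def)
  then show ?thesis using assms unfolding cov_def indep_def by auto
qed

lemma vertex_cover_cov:
  assumes "indep I"
  shows "vertex_cover VW EW (cov I)"
  unfolding vertex_cover_def
proof (intro conjI ballI)
  show "cov I \<subseteq> VW" by (rule cov_subset[OF assms])
  fix e assume "e \<in> EW"
  then consider f where "f \<in> E" "e = Inl ` f" | a x where "a < length Ws" "x \<in> set (Ws ! a)" "e = {Inl x, Inr a}"
    unfolding whiskered_edges_def by blast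
  then show "e \<inter> cov I \<noteq> {}"
  proof cases
    case 1
    then obtain u v where "u \<in> V" "v \<in> V" "f = {u, v}" using graph by (auto simp: simple_graph_def)
    moreover have "u \<notin> I \<or> v \<notin> I" using assms 1 calculation unfolding indep_def by blast
    ultimately show ?thesis using 1 Inl_in_cov by auto
  next
    case 2
    then have "x \<in> V" "bl x = a" using block_subset block_unique by auto
    then show ?thesis using 2 Inl_in_cov[of x I] Inr_in_cov[of a I] by auto
  qed
qed

text \<open>The complement of a vertex cover inside \<open>V\<close> is independent, and the cover must use the whisker
  of every block that meets this complement.\<close>

lemma vertex_cover_contains_cov:
  assumes "vertex_cover VW EW C"
  shows "indep {x \<in> V. Inl x \<notin> C}" and "cov {x \<in> V. Inl x \<notin> C} \<subseteq> C"
proof -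
  let ?I = "{x \<in> V. Inl x \<notin> C}"
  show "indep ?I"
    unfolding indep_def
  proof (intro conjI ballI notI)
    fix u v assume *: "u \<in> ?I" "v \<in> ?I" "{u, v} \<in> E"
    then have "Inl ` {u, v} \<in> EW" unfolding whiskered_edges_def by blast
    then show False using assms * unfolding vertex_cover_def by auto
  qed auto
  show "cov ?I \<subseteq> C"
  proof
    fix v assume v: "v \<in> cov ?I"
    then consider x where "x \<in> V" "x \<notin> ?I" "v = Inl x" | x where "x \<in> ?I" "v = Inr (bl x)"
      unfolding cov_def by auto
    then show "v \<in> C"
    proof cases
      case 2
      then have "{Inl x, Inr (bl x)} \<in> EW"
        using block[of x] unfolding whiskered_edges_def by blast
      then show ?thesis using assms 2 unfolding vertex_cover_def by auto
    qed auto
  qed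
qed

lemma minimal_vertex_cover_iff:
  "minimal_vertex_cover VW EW C \<longleftrightarrow> (\<exists>I. indep I \<and> C = cov I)"
proof
  assume C: "minimal_vertex_cover VW EW C"
  then have "vertex_cover VW EW C" by (simp add: minimal_vertex_cover_def)
  then show "\<exists>I. indep I \<and> C = cov I"
    using C vertex_cover_contains_cov[of C] vertex_cover_cov unfolding minimal_vertex_cover_def by metis
next
  assume "\<exists>I. indep I \<and> C = cov I"
  then obtain I where I: "indep I" "C = cov I" by blast
  show "minimal_vertex_cover VW EW C"
    unfolding minimal_vertex_cover_def
  proof (intro conjI allI impI)
    show "vertex_cover VW EW C" using I vertex_cover_cov by simp
    fix C' assume C': "vertex_cover VW EW C' \<and> C' \<subseteq> C"
    let ?J = "{x \<in> V. Inl x \<notin> C'}"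
    have J: "indep ?J" "cov ?J \<subseteq> C'" using C' vertex_cover_contains_cov[of C'] by auto
    have "I \<subseteq> ?J" using C' I Inl_in_cov[of _ I] unfolding indep_def by blast
    moreover have "?J \<subseteq> I"
    proof
      fix x assume x: "x \<in> ?J"
      \<comment> \<open>the whisker of \<open>x\<close> lies in \<open>C\<close>, so \<open>I\<close> meets the block of \<open>x\<close>; it does so in \<open>x\<close>, as \<open>?J\<close> is independent\<close>
      then have "Inr (bl x) \<in> cov I" using J C' I Inr_in_cov by blast
      then obtain y where y: "y \<in> I" "bl y = bl x" unfolding Inr_in_cov by auto
      then have "y = x" using \<open>I \<subseteq> ?J\<close> x block_inj[OF J(1)] unfolding inj_on_def by blast
      then show "x \<in> I" using y by simp
    qed
    ultimately have "?J = I" by blast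
    then show "C' = C" using J C' I by auto
  qed
qed

text \<open>The basis symbols are the pairs \<open>(cov I, \<sigma>)\<close> with \<open>I\<close> independent and \<open>\<sigma> \<subseteq> I\<close>: the faces
  of a cubical complex built on the independence complex.\<close>

lemma symbols_iff:
  "(C, \<sigma>) \<in> symbols V E Ws p \<longleftrightarrow> (\<exists>I. indep I \<and> C = cov I \<and> \<sigma> \<subseteq> I \<and> card \<sigma> = p)"
proof -
  have "indep I \<Longrightarrow> {x \<in> V. Inl x \<notin> cov I} = I" for I
    using Inl_in_cov unfolding indep_def by blast
  then show ?thesis unfolding symbols_def minimal_vertex_cover_iff by auto
qed

text \<open>Both sides are the degree of \<open>cov I \<union> {x}\<close>.  This makes the boundary map homogeneous, and its
  composition with the augmentation zero.\<close>

lemma mdeg_of_cov_remove: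
  assumes "indep I" "x \<in> I"
  shows "Poly_Mapping.single (Inr (bl x)) 1 + mdeg_of (cov (I - {x})) =
    Poly_Mapping.single (Inl x) 1 + mdeg_of (cov I)"
proof -
  let ?D = "cov I - {Inr (bl x)}"
  have fin: "finite ?D" using finite_cov[OF assms(1)] by simp
  have "cov (I - {x}) = insert (Inl x) ?D" using cov_remove[OF assms] by simp
  moreover have "Inl x \<notin> ?D" using assms Inl_in_cov by simp
  moreover have "cov I = insert (Inr (bl x)) ?D" using assms Inr_in_cov by auto
  ultimately show ?thesis
    using mdeg_of_insert[OF fin, of "Inl x"] mdeg_of_insert[OF fin, of "Inr (bl x)"]
    by (simp add: add.left_commute)
qed

end

section \<open>The boundary map\<close>

lemma minus_one_power_eq_single:
  "(- 1 :: ('v, 'k::field) mpoly) ^ n = Poly_Mapping.single 0 ((- 1) ^ n)"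
proof (induction n)
  case (Suc n)
  have "(- 1 :: ('v, 'k) mpoly) = Poly_Mapping.single 0 (- 1)"
    by (simp add: single_uminus)
  then show ?case using Suc by (simp add: mult_single del: single_uminus)
qed simp

lemma scale_sign_mterm: "scale ((- 1) ^ n) (mterm s t c) = mterm s t ((- 1) ^ n * c)"
  by (simp add: minus_one_power_eq_single scale_mterm)

lemma scale_Var_mterm: "scale (Var v) (mterm s t c) = mterm s (Poly_Mapping.single v 1 + t) c"
  by (simp add: Var_def scale_mterm)

lemma symb_eq_mterm: "symb C \<sigma> = mterm (C, \<sigma>) 0 1"
  by (simp add: symb_def mterm_def)

lemma boundary_eq_additive_ext:
  "boundary Ws = additive_ext (\<lambda>s a. scale a (symbol_boundary Ws s))"
  by (simp add: boundary_def additive_ext_def fun_eq_iff)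

lemma boundary_add: "boundary Ws (\<phi> + \<psi>) = boundary Ws \<phi> + boundary Ws \<psi>"
  unfolding boundary_eq_additive_ext by (rule additive_ext_add) (simp_all add: scale_add_left)

lemma boundary_scale: "boundary Ws (scale c \<phi>) = scale c (boundary Ws \<phi>)"
  unfolding boundary_eq_additive_ext
  by (rule additive_ext_scale) (simp_all add: scale_scale scale_add_right)

lemmas boundary_uminus = additive_uminus[of "boundary Ws", OF boundary_add] for Ws
lemmas boundary_diff = additive_diff[of "boundary Ws", OF boundary_add] for Ws
lemmas boundary_sum = additive_sum[of "boundary Ws", OF boundary_add] for Ws
lemmas boundary_zero = additive_zero[of "boundary Ws", OF boundary_add] for Ws

context clique_whiskering
begin

text \<open>The sign of the face in direction \<open>x\<close>.\<close>

abbreviation "eps \<sigma> x \<equiv> (- 1) ^ alpha Ws \<sigma> x"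

text \<open>The face of \<open>c t \<cdot> (cov I, \<sigma>)\<close> in direction \<open>x \<in> \<sigma>\<close>, without its sign.\<close>

definition bterm ::
  "'v set \<Rightarrow> 'v set \<Rightarrow> ('v + nat \<Rightarrow>\<^sub>0 nat) \<Rightarrow> 'k \<Rightarrow> 'v \<Rightarrow> ('v symb \<Rightarrow>\<^sub>0 ('v + nat, 'k::field) mpoly)" where
  "bterm I \<sigma> t c x =
     mterm (cov (I - {x}), \<sigma> - {x}) (Poly_Mapping.single (Inr (bl x)) 1 + t) c -
     mterm (cov I, \<sigma> - {x}) (Poly_Mapping.single (Inl x) 1 + t) c"

lemma bterm_uminus: "bterm I \<sigma> t (- c) x = - bterm I \<sigma> t c x"
  by (simp add: bterm_def mterm_uminus)

lemma boundary_mterm: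
  assumes "indep I" "\<sigma> \<subseteq> I"
  shows "boundary Ws (mterm (cov I, \<sigma>) t c) = (\<Sum>x\<in>\<sigma>. bterm I \<sigma> t (eps \<sigma> x * c) x)"
proof -
  have "boundary Ws (mterm (cov I, \<sigma>) t c) =
      scale (Poly_Mapping.single t c) (symbol_boundary Ws (cov I, \<sigma>))"
    unfolding boundary_eq_additive_ext mterm_def by (rule additive_ext_single) simp
  also have "\<dots> = (\<Sum>x\<in>\<sigma>. bterm I \<sigma> t (eps \<sigma> x * c) x)"
    unfolding symbol_boundary_def prod.case Let_def scale_sum_right
  proof (rule sum.cong)
    fix x assume "x \<in> \<sigma>"
    then have "cov I - {Inr (bl x)} \<union> {Inl x} = cov (I - {x})"
      using cov_remove[OF assms(1)] assms(2) by blast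
    then show "scale (Poly_Mapping.single t c) (scale ((- 1) ^ alpha Ws \<sigma> x)
        (scale (Var (Inr (bl x))) (symb (cov I - {Inr (bl x)} \<union> {Inl x}) (\<sigma> - {x})) -
          scale (Var (Inl x)) (symb (cov I) (\<sigma> - {x})))) = bterm I \<sigma> t (eps \<sigma> x * c) x"
      by (simp add: symb_eq_mterm scale_Var_mterm scale_diff_right scale_sign_mterm scale_mterm
          bterm_def add.commute mult.commute)
  qed simp
  finally show ?thesis .
qed

lemma alpha_remove_smaller: "vertex_less Ws x y \<Longrightarrow> alpha Ws (\<sigma> - {x}) y = alpha Ws \<sigma> y"
  unfolding alpha_def by (rule arg_cong[of _ _ card]) (use less_asym in blast)

lemma alpha_remove_greater:
  assumes "finite \<sigma>" "y \<in> \<sigma>" "vertex_less Ws x y"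
  shows "alpha Ws \<sigma> x = Suc (alpha Ws (\<sigma> - {y}) x)"
proof -
  have "{z \<in> \<sigma>. vertex_less Ws x z} = insert y {z \<in> \<sigma> - {y}. vertex_less Ws x z}"
    using assms by auto
  then show ?thesis unfolding alpha_def using assms(1) by simp
qed

lemma alpha_top:
  assumes "\<And>y. y \<in> \<sigma> - {m} \<Longrightarrow> vertex_less Ws y m"
  shows "alpha Ws \<sigma> m = 0"
proof -
  have "{y \<in> \<sigma>. vertex_less Ws m y} = {}"
    using assms less_asym less_irrefl by blast
  then show ?thesis unfolding alpha_def by (simp only: card.empty)
qed

lemma eps_swap:
  assumes "\<sigma> \<subseteq> V" "x \<in> \<sigma>" "y \<in> \<sigma>" "x \<noteq> y"
  shows "eps (\<sigma> - {x}) y * eps \<sigma> x = - (eps (\<sigma> - {y}) x * eps \<sigma> y :: 'k::field)"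
proof -
  have fin: "finite \<sigma>" using assms(1) finite_V finite_subset by blast
  consider "vertex_less Ws x y" | "vertex_less Ws y x" using less_total assms by blast
  then show ?thesis
    by cases (use assms fin in \<open>simp_all add: alpha_remove_smaller alpha_remove_greater mult.commute\<close>)
qed

text \<open>The part of the double boundary that removes first \<open>x\<close> and then \<open>y\<close> is, up to its sign,
  symmetric in \<open>x\<close> and \<open>y\<close>.\<close>

lemma boundary_boundary_mterm:
  assumes I: "indep I" "\<sigma> \<subseteq> I"
  shows "boundary Ws (boundary Ws (mterm (cov I, \<sigma>) t (c :: 'k::field))) = 0"
proof -
  define f where "f x y =
    bterm (I - {x}) (\<sigma> - {x}) (Poly_Mapping.single (Inr (bl x)) 1 + t) (eps (\<sigma> - {x}) y * (eps \<sigma> x * c)) y -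
    bterm I (\<sigma> - {x}) (Poly_Mapping.single (Inl x) 1 + t) (eps (\<sigma> - {x}) y * (eps \<sigma> x * c)) y" for x y
  have "boundary Ws (bterm I \<sigma> t (eps \<sigma> x * c) x) = (\<Sum>y\<in>\<sigma> - {x}. f x y)" if "x \<in> \<sigma>" for x
  proof -
    have "indep (I - {x})" "\<sigma> - {x} \<subseteq> I - {x}" "\<sigma> - {x} \<subseteq> I"
      using I indep_subset[of I] by auto
    then show ?thesis
      unfolding bterm_def[of I \<sigma>] boundary_diff f_def using I(1)
      by (simp add: boundary_mterm sum_subtractf)
  qed
  then have "boundary Ws (boundary Ws (mterm (cov I, \<sigma>) t c)) = (\<Sum>x\<in>\<sigma>. \<Sum>y\<in>\<sigma> - {x}. f x y)"
    by (simp add: boundary_mterm[OF I] boundary_sum)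
  also have "\<dots> = 0"
  proof (rule sum_antisymmetric_eq_0)
    show "finite \<sigma>" using I indep_finite finite_subset by blast
    fix x y assume xy: "x \<in> \<sigma>" "y \<in> \<sigma>" "x \<noteq> y"
    have sign: "eps (\<sigma> - {x}) y * (eps \<sigma> x * c) = - (eps (\<sigma> - {y}) x * (eps \<sigma> y * c))"
    proof -
      have "\<sigma> \<subseteq> V" using I unfolding indep_def by blast
      then show ?thesis using eps_swap[of \<sigma> x y, where 'k = 'k] xy by (simp flip: mult.assoc)
    qed
    have sets: "A - {y} - {x} = A - {x} - {y}" for A :: "'v set" by blast
    show "f x y + f y x = 0"
      unfolding f_def sign bterm_uminus by (simp add: bterm_def sets add.left_commute)
  qed
  finally show ?thesis .
qed

section \<open>A contracting homotopy\<close>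

text \<open>The vertices that are active in the term \<open>t \<cdot> (C, \<sigma>)\<close>: those of \<open>\<sigma>\<close>, and those of the independent
  set \<open>{x \<in> V. Inl x \<notin> C}\<close> that divide the monomial \<open>t\<close>.\<close>

definition active :: "'v symb \<Rightarrow> ('v + nat \<Rightarrow>\<^sub>0 nat) \<Rightarrow> 'v set" where
  "active = (\<lambda>(C, \<sigma>) t. \<sigma> \<union> {x \<in> V. Inl x \<notin> C \<and> Poly_Mapping.lookup t (Inl x) \<noteq> 0})"

text \<open>\<open>m\<close> is the largest element of \<open>A\<close>.\<close>

definition is_top :: "'v set \<Rightarrow> 'v \<Rightarrow> bool" where
  "is_top A m \<longleftrightarrow> m \<in> A \<and> (\<forall>y\<in>A - {m}. vertex_less Ws y m)"

text \<open>The homotopy on a term.  If the largest active vertex \<open>m\<close> is not in \<open>\<sigma>\<close> then \<open>m\<close> divides \<open>t\<close>, so that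
  the truncated difference of exponents is the monomial \<open>t / m\<close>.\<close>

definition homotopy_term ::
  "'v symb \<Rightarrow> ('v + nat \<Rightarrow>\<^sub>0 nat) \<Rightarrow> 'k \<Rightarrow> ('v symb \<Rightarrow>\<^sub>0 ('v + nat, 'k::field) mpoly)" where
  "homotopy_term = (\<lambda>(C, \<sigma>) t c.
     if active (C, \<sigma>) t = {} then 0
     else let m = (SOME m. is_top (active (C, \<sigma>) t) m) in
       if m \<in> \<sigma> then 0 else - mterm (C, insert m \<sigma>) (t - Poly_Mapping.single (Inl m) 1) c)"

text \<open>The homotopy is additive, but not linear over the polynomial ring: which vertex is added depends
  on the monomial.\<close>

definition homotopy ::
  "('v symb \<Rightarrow>\<^sub>0 ('v + nat, 'k::field) mpoly) \<Rightarrow> ('v symb \<Rightarrow>\<^sub>0 ('v + nat, 'k) mpoly)" where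
  "homotopy = additive_ext (\<lambda>s. additive_ext (homotopy_term s))"

lemma homotopy_term_zero [simp]: "homotopy_term s t 0 = 0"
  by (simp add: homotopy_term_def Let_def split: prod.split)

lemma homotopy_term_add: "homotopy_term s t (a + b) = homotopy_term s t a + homotopy_term s t b"
  by (simp add: homotopy_term_def Let_def mterm_add split: prod.split)

lemma homotopy_add: "homotopy (\<phi> + \<psi>) = homotopy \<phi> + homotopy \<psi>"
  unfolding homotopy_def
  by (rule additive_ext_add) (simp_all add: additive_ext_add homotopy_term_add)

lemmas homotopy_diff = additive_diff[of homotopy, OF homotopy_add]
lemmas homotopy_sum = additive_sum[of homotopy, OF homotopy_add]
lemmas homotopy_zero = additive_zero[of homotopy, OF homotopy_add]

lemma homotopy_mterm: "homotopy (mterm s t c) = homotopy_term s t c"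
  unfolding homotopy_def mterm_def by (simp add: additive_ext_single)

lemma is_top_unique: "is_top A m \<Longrightarrow> is_top A m' \<Longrightarrow> m = m'"
  unfolding is_top_def using less_asym by blast

lemma is_top_subset: "is_top A m \<Longrightarrow> B \<subseteq> A \<Longrightarrow> m \<in> B \<Longrightarrow> is_top B m"
  unfolding is_top_def by blast

lemma obtain_top:
  assumes "A \<subseteq> V" "A \<noteq> {}"
  obtains m where "is_top A m"
  using exists_top[OF assms] unfolding is_top_def by blast

lemma homotopy_mterm_top:
  assumes "is_top (active (C, \<sigma>) t) m"
  shows "homotopy (mterm (C, \<sigma>) t c) =
    (if m \<in> \<sigma> then 0 else - mterm (C, insert m \<sigma>) (t - Poly_Mapping.single (Inl m) 1) c)"
proof -
  have "(SOME m. is_top (active (C, \<sigma>) t) m) = m"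
    using assms is_top_unique by (intro some_equality) auto
  moreover have "active (C, \<sigma>) t \<noteq> {}" using assms unfolding is_top_def by auto
  ultimately show ?thesis by (simp add: homotopy_mterm homotopy_term_def)
qed

lemma homotopy_mterm_no_active: "active s t = {} \<Longrightarrow> homotopy (mterm s t c) = 0"
  by (cases s) (simp add: homotopy_mterm homotopy_term_def)

lemma active_cov:
  assumes "indep I"
  shows "active (cov I, \<sigma>) t = \<sigma> \<union> {x \<in> I. Poly_Mapping.lookup t (Inl x) \<noteq> 0}"
  using assms Inl_in_cov[of _ I] unfolding active_def indep_def by auto

lemma active_subset: "indep I \<Longrightarrow> \<sigma> \<subseteq> I \<Longrightarrow> active (cov I, \<sigma>) t \<subseteq> I"
  by (auto simp: active_cov)

text \<open>In the first summand of the face in direction \<open>x\<close> the vertex \<open>x\<close> is no longer active.  In the second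
  summand it remains active, as a divisor of the monomial.\<close>

lemma active_front:
  assumes "indep I" "\<sigma> \<subseteq> I"
  shows "active (cov (I - {x}), \<sigma> - {x}) (Poly_Mapping.single (Inr a) k + t) = active (cov I, \<sigma>) t - {x}"
proof -
  have "indep (I - {x})" using assms indep_subset by blast
  then show ?thesis using assms by (auto simp: active_cov lookup_add lookup_single)
qed

lemma active_back:
  assumes "indep I" "\<sigma> \<subseteq> I" "x \<in> \<sigma>"
  shows "active (cov I, \<sigma> - {x}) (Poly_Mapping.single (Inl x) 1 + t) = active (cov I, \<sigma>) t"
  using assms by (auto simp: active_cov lookup_add lookup_single when_def)

text \<open>As \<open>m\<close> is larger than all elements of \<open>\<sigma>\<close>, inserting it changes the signs of all other faces, which
  therefore cancel; the face in direction \<open>m\<close> has sign \<open>1\<close> and gives the right hand side.\<close>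

lemma homotopy_identity_not_in:
  assumes I: "indep I" "\<sigma> \<subseteq> I" and m: "is_top (active (cov I, \<sigma>) t) m" "m \<notin> \<sigma>"
  shows "boundary Ws (homotopy (mterm (cov I, \<sigma>) t (c :: 'k::field))) + homotopy (boundary Ws (mterm (cov I, \<sigma>) t c)) =
    mterm (cov I, \<sigma>) t c -
    mterm (cov (I - {m}), \<sigma>) (Poly_Mapping.single (Inr (bl m)) 1 + (t - Poly_Mapping.single (Inl m) 1)) c"
proof -
  let ?\<sigma> = "insert m \<sigma>" and ?t = "t - Poly_Mapping.single (Inl m) 1"
  have mA: "m \<in> active (cov I, \<sigma>) t" using m unfolding is_top_def by blast
  have mI: "m \<in> I" and tm: "Poly_Mapping.lookup t (Inl m) \<noteq> 0"
    using mA m(2) active_cov[OF I(1)] by auto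
  have fin: "finite \<sigma>" using I indep_finite finite_subset by blast
  have less: "vertex_less Ws x m" if "x \<in> \<sigma>" for x
    using that m unfolding is_top_def by (auto simp: active_cov I)
  have alpha_m: "alpha Ws ?\<sigma> m = 0"
    by (rule alpha_top) (use less in auto)
  have alpha: "alpha Ws ?\<sigma> x = Suc (alpha Ws \<sigma> x)" if "x \<in> \<sigma>" for x
    using alpha_remove_greater[of ?\<sigma> m x] fin that less m(2) by simp
  have "boundary Ws (homotopy (mterm (cov I, \<sigma>) t c)) =
      - (\<Sum>x\<in>?\<sigma>. bterm I ?\<sigma> ?t (eps ?\<sigma> x * c) x)"
    unfolding homotopy_mterm_top[OF m(1)] using m(2) I mI
    by (simp add: boundary_uminus boundary_mterm)
  also have "\<dots> = - bterm I ?\<sigma> ?t c m + (\<Sum>x\<in>\<sigma>. bterm I ?\<sigma> ?t (eps \<sigma> x * c) x)"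
    using fin m(2) by (simp add: alpha_m alpha bterm_uminus sum_negf)
  also have "bterm I ?\<sigma> ?t c m = mterm (cov (I - {m}), \<sigma>) (Poly_Mapping.single (Inr (bl m)) 1 + ?t) c -
      mterm (cov I, \<sigma>) t c"
    using m(2) single_add_diff_cancel(1)[OF tm] by (simp add: bterm_def)
  finally have 1: "boundary Ws (homotopy (mterm (cov I, \<sigma>) t c)) =
      mterm (cov I, \<sigma>) t c - mterm (cov (I - {m}), \<sigma>) (Poly_Mapping.single (Inr (bl m)) 1 + ?t) c +
      (\<Sum>x\<in>\<sigma>. bterm I ?\<sigma> ?t (eps \<sigma> x * c) x)"
    by simp
  have "homotopy (bterm I \<sigma> t k x) = - bterm I ?\<sigma> ?t k x" if x: "x \<in> \<sigma>" for k :: 'k and x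
  proof -
    have "x \<noteq> m" using x m(2) by blast
    have "is_top (active (cov (I - {x}), \<sigma> - {x}) (Poly_Mapping.single (Inr (bl x)) 1 + t)) m"
      unfolding active_front[OF I] by (rule is_top_subset[OF m(1)]) (use mA \<open>x \<noteq> m\<close> in auto)
    then have "homotopy (mterm (cov (I - {x}), \<sigma> - {x}) (Poly_Mapping.single (Inr (bl x)) 1 + t) k) =
        - mterm (cov (I - {x}), insert m (\<sigma> - {x})) (Poly_Mapping.single (Inr (bl x)) 1 + ?t) k"
      using m(2) by (simp add: homotopy_mterm_top single_add_diff_cancel(2)[OF tm] del: One_nat_def)
    moreover have "homotopy (mterm (cov I, \<sigma> - {x}) (Poly_Mapping.single (Inl x) 1 + t) k) =
        - mterm (cov I, insert m (\<sigma> - {x})) (Poly_Mapping.single (Inl x) 1 + ?t) k"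
      using m active_back[OF I x] by (simp add: homotopy_mterm_top single_add_diff_cancel(2)[OF tm] del: One_nat_def)
    moreover have "insert m (\<sigma> - {x}) = ?\<sigma> - {x}" using \<open>x \<noteq> m\<close> by blast
    ultimately show ?thesis by (simp add: bterm_def homotopy_diff)
  qed
  then have 2: "homotopy (boundary Ws (mterm (cov I, \<sigma>) t c)) = - (\<Sum>x\<in>\<sigma>. bterm I ?\<sigma> ?t (eps \<sigma> x * c) x)"
    by (simp add: boundary_mterm[OF I] homotopy_sum sum_negf)
  show ?thesis unfolding 1 2 by simp
qed

text \<open>Only the face in direction \<open>m\<close> contributes: \<open>m\<close> remains the largest active vertex of the other
  faces and lies in their index sets, so the homotopy kills them.\<close>

lemma homotopy_identity_in:
  assumes I: "indep I" "\<sigma> \<subseteq> I" and m: "is_top (active (cov I, \<sigma>) t) m" "m \<in> \<sigma>"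
  shows "boundary Ws (homotopy (mterm (cov I, \<sigma>) t (c :: 'k::field))) + homotopy (boundary Ws (mterm (cov I, \<sigma>) t c)) =
    mterm (cov I, \<sigma>) t c +
    homotopy (mterm (cov (I - {m}), \<sigma> - {m}) (Poly_Mapping.single (Inr (bl m)) 1 + t) c)"
proof -
  have mA: "m \<in> active (cov I, \<sigma>) t" using m unfolding is_top_def by blast
  have fin: "finite \<sigma>" using I indep_finite finite_subset by blast
  have less: "vertex_less Ws x m" if "x \<in> \<sigma> - {m}" for x
    using that m unfolding is_top_def by (auto simp: active_cov I)
  have alpha_m: "alpha Ws \<sigma> m = 0"
    by (rule alpha_top) (use less in auto)
  have other: "homotopy (bterm I \<sigma> t k x) = 0" if x: "x \<in> \<sigma> - {m}" for k :: 'k and x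
  proof -
    have "is_top (active (cov (I - {x}), \<sigma> - {x}) (Poly_Mapping.single (Inr (bl x)) 1 + t)) m"
      unfolding active_front[OF I] by (rule is_top_subset[OF m(1)]) (use mA x in auto)
    moreover have "is_top (active (cov I, \<sigma> - {x}) (Poly_Mapping.single (Inl x) 1 + t)) m"
      using active_back[OF I, of x t] x m by simp
    ultimately show ?thesis
      using m(2) x by (auto simp: bterm_def homotopy_diff homotopy_mterm_top)
  qed
  have "is_top (active (cov I, \<sigma> - {m}) (Poly_Mapping.single (Inl m) 1 + t)) m"
    using active_back[OF I, of m t] m by simp
  then have "homotopy (mterm (cov I, \<sigma> - {m}) (Poly_Mapping.single (Inl m) 1 + t) c) = - mterm (cov I, \<sigma>) t c"
    using m(2) by (simp add: homotopy_mterm_top insert_absorb)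
  then have "homotopy (bterm I \<sigma> t c m) = mterm (cov I, \<sigma>) t c +
      homotopy (mterm (cov (I - {m}), \<sigma> - {m}) (Poly_Mapping.single (Inr (bl m)) 1 + t) c)"
    by (simp add: bterm_def homotopy_diff)
  then have "homotopy (boundary Ws (mterm (cov I, \<sigma>) t c)) = mterm (cov I, \<sigma>) t c +
      homotopy (mterm (cov (I - {m}), \<sigma> - {m}) (Poly_Mapping.single (Inr (bl m)) 1 + t) c)"
    by (simp add: boundary_mterm[OF I] homotopy_sum homotopy_add sum.remove[OF fin m(2)] other alpha_m)
  moreover have "homotopy (mterm (cov I, \<sigma>) t c) = 0"
    using homotopy_mterm_top[OF m(1)] m(2) by simp
  ultimately show ?thesis by (simp add: boundary_zero)
qed


section \<open>Exactness\<close>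

text \<open>The monomial terms of the \<open>p\<close>-th free module.\<close>

definition res_term :: "nat \<Rightarrow> 'v symb \<Rightarrow> ('v + nat \<Rightarrow>\<^sub>0 nat) \<Rightarrow> bool" where
  "res_term p s t \<longleftrightarrow> s \<in> symbols V E Ws p \<and> Poly_Mapping.keys t \<subseteq> VW"

lemma carrier_resolution_module:
  "carrier (resolution_module V E Ws p) = supported (res_term p)"
  by (simp add: resolution_module_def carrier_free_module_on res_term_def[abs_def])

lemma res_termE:
  assumes "res_term p s t"
  obtains I \<sigma> where "s = (cov I, \<sigma>)" "indep I" "\<sigma> \<subseteq> I" "card \<sigma> = p" "finite \<sigma>" "Poly_Mapping.keys t \<subseteq> VW"
proof -
  obtain C \<sigma> where s: "s = (C, \<sigma>)" by (cases s)
  then obtain I where I: "indep I" "C = cov I" "\<sigma> \<subseteq> I" "card \<sigma> = p"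
    using assms symbols_iff unfolding res_term_def by blast
  moreover have "finite \<sigma>" using I indep_finite finite_subset by blast
  ultimately show thesis using that s assms unfolding res_term_def by blast
qed

lemma res_termI:
  "indep I \<Longrightarrow> \<sigma> \<subseteq> I \<Longrightarrow> card \<sigma> = p \<Longrightarrow> Poly_Mapping.keys t \<subseteq> VW \<Longrightarrow> res_term p (cov I, \<sigma>) t"
  using symbols_iff unfolding res_term_def by auto

lemma keys_single_add: "Poly_Mapping.keys t \<subseteq> VW \<Longrightarrow> v \<in> VW \<Longrightarrow> Poly_Mapping.keys (Poly_Mapping.single v (k::nat) + t) \<subseteq> VW"
  using keys_add[of "Poly_Mapping.single v k" t] by (auto split: if_splits)

lemma Inl_VW: "x \<in> V \<Longrightarrow> Inl x \<in> VW"
  by (simp add: whiskered_vertices_def)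

lemma Inr_VW: "x \<in> V \<Longrightarrow> Inr (bl x) \<in> VW"
  using block(1) by (simp add: whiskered_vertices_def)

lemma boundary_in_supported:
  fixes \<phi> :: "'v symb \<Rightarrow>\<^sub>0 ('v + nat, 'k::field) mpoly"
  assumes "\<phi> \<in> supported P" "\<And>s t c. P s t \<Longrightarrow> boundary Ws (mterm s t (c :: 'k)) \<in> supported Q"
  shows "boundary Ws \<phi> \<in> supported Q"
  using assms(1) by (induction rule: supported_induct) (simp_all add: assms boundary_zero boundary_add supported_add)

text \<open>The boundary maps the terms of the \<open>p+1\<close>-st module to the \<open>p\<close>-th one and preserves degrees.\<close>

lemma boundary_mterm_supported:
  assumes I: "indep I" "\<sigma> \<subseteq> I" and p: "card \<sigma> = Suc p" and t: "Poly_Mapping.keys t \<subseteq> VW"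
  shows "boundary Ws (mterm (cov I, \<sigma>) t c) \<in>
    supported (\<lambda>s u. res_term p s u \<and> u + symbol_mdeg s = t + symbol_mdeg (cov I, \<sigma>))"
  unfolding boundary_mterm[OF I]
proof (rule supported_sum)
  fix x assume x: "x \<in> \<sigma>"
  have fin: "finite \<sigma>" using I indep_finite finite_subset by blast
  have V: "x \<in> V" and xI: "x \<in> I" and I': "indep (I - {x})"
    using x I indep_subset[of I] unfolding indep_def by blast+
  have card: "card (\<sigma> - {x}) = p" using p x fin by simp
  let ?\<sigma>' = "Inl ` (\<sigma> - {x}) :: ('v + nat) set"
  have "mdeg_of (insert (Inl x) ?\<sigma>') = Poly_Mapping.single (Inl x) 1 + mdeg_of ?\<sigma>'"
    by (rule mdeg_of_insert) (use fin in auto)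
  moreover have "insert (Inl x) ?\<sigma>' = Inl ` \<sigma>" using x by blast
  ultimately have deg: "symbol_mdeg (cov I, \<sigma>) =
      mdeg_of (cov I) + (Poly_Mapping.single (Inl x) 1 + mdeg_of (Inl ` (\<sigma> - {x})))"
    by (simp add: symbol_mdeg_def)
  have "Poly_Mapping.single (Inr (bl x)) 1 + t + symbol_mdeg (cov (I - {x}), \<sigma> - {x}) =
      t + (Poly_Mapping.single (Inr (bl x)) 1 + mdeg_of (cov (I - {x}))) + mdeg_of (Inl ` (\<sigma> - {x}))"
    by (simp add: symbol_mdeg_def ac_simps)
  also have "\<dots> = t + symbol_mdeg (cov I, \<sigma>)"
    unfolding mdeg_of_cov_remove[OF I(1) xI] deg by (simp add: ac_simps)
  finally have deg_front: "Poly_Mapping.single (Inr (bl x)) 1 + t + symbol_mdeg (cov (I - {x}), \<sigma> - {x}) =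
      t + symbol_mdeg (cov I, \<sigma>)" .
  have deg_back: "Poly_Mapping.single (Inl x) 1 + t + symbol_mdeg (cov I, \<sigma> - {x}) =
      t + symbol_mdeg (cov I, \<sigma>)"
    unfolding deg by (simp add: symbol_mdeg_def ac_simps)
  show "bterm I \<sigma> t (eps \<sigma> x * c) x \<in>
      supported (\<lambda>s u. res_term p s u \<and> u + symbol_mdeg s = t + symbol_mdeg (cov I, \<sigma>))"
    unfolding bterm_def
    by (intro supported_diff supported_mterm conjI res_termI keys_single_add deg_front deg_back)
      (use I I' t card V Inl_VW Inr_VW in auto)
qed

lemma boundary_res:
  assumes "\<phi> \<in> supported (res_term (Suc p))"
  shows "boundary Ws \<phi> \<in> supported (res_term p)"
  using assms
  by (rule boundary_in_supported)
    (auto elim!: res_termE intro: supported_mono[OF boundary_mterm_supported])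

lemma boundary_boundary:
  assumes "\<phi> \<in> supported (res_term p)"
  shows "boundary Ws (boundary Ws \<phi>) = 0"
  using assms
  by (induction rule: supported_induct)
    (auto simp: boundary_add boundary_zero elim!: res_termE intro: boundary_boundary_mterm)

text \<open>The homotopy creates no new active vertices.\<close>

lemma homotopy_mterm_res:
  assumes I: "indep I" "\<sigma> \<subseteq> I" and t: "Poly_Mapping.keys t \<subseteq> VW"
  shows "homotopy (mterm (cov I, \<sigma>) t c) \<in>
    supported (\<lambda>s u. res_term (Suc (card \<sigma>)) s u \<and> active s u \<subseteq> active (cov I, \<sigma>) t)"
proof (cases "active (cov I, \<sigma>) t = {}")
  case True
  then show ?thesis by (simp add: homotopy_mterm_no_active)
next
  case False
  have fin: "finite \<sigma>" using I indep_finite finite_subset by blast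
  have "active (cov I, \<sigma>) t \<subseteq> V" using active_subset[OF I] I unfolding indep_def by blast
  then obtain m where m: "is_top (active (cov I, \<sigma>) t) m" using False obtain_top by metis
  let ?t = "t - Poly_Mapping.single (Inl m) 1"
  have mA: "m \<in> active (cov I, \<sigma>) t" using m unfolding is_top_def by blast
  have "mterm (cov I, insert m \<sigma>) ?t c \<in>
      supported (\<lambda>s u. res_term (Suc (card \<sigma>)) s u \<and> active s u \<subseteq> active (cov I, \<sigma>) t)"
    if "m \<notin> \<sigma>"
  proof (intro supported_mterm conjI res_termI)
    show "insert m \<sigma> \<subseteq> I" using mA active_subset[OF I] I by blast
    show "card (insert m \<sigma>) = Suc (card \<sigma>)" using that fin by simp
    show "Poly_Mapping.keys ?t \<subseteq> VW" using t keys_diff_nat[of t "Poly_Mapping.single (Inl m) 1"] by blast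
    show "active (cov I, insert m \<sigma>) ?t \<subseteq> active (cov I, \<sigma>) t"
      using mA by (auto simp: active_cov I lookup_minus)
  qed (rule I)
  then show ?thesis by (auto simp: homotopy_mterm_top[OF m] intro: supported_uminus)
qed

lemma homotopy_res:
  assumes "\<phi> \<in> supported (res_term p)"
  shows "homotopy \<phi> \<in> supported (res_term (Suc p))"
  using assms
proof (induction rule: supported_induct)
  case (mterm s t c)
  then show ?case
    by (elim res_termE) (auto intro: supported_mono[OF homotopy_mterm_res])
qed (auto simp: homotopy_zero homotopy_add supported_add)

text \<open>The deviation of the homotopy from a contraction.\<close>

definition residual ::
  "('v symb \<Rightarrow>\<^sub>0 ('v + nat, 'k::field) mpoly) \<Rightarrow> ('v symb \<Rightarrow>\<^sub>0 ('v + nat, 'k) mpoly)" where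
  "residual \<phi> = \<phi> - (boundary Ws (homotopy \<phi>) + homotopy (boundary Ws \<phi>))"

lemma residual_add: "residual (\<phi> + \<psi>) = residual \<phi> + residual \<psi>"
  by (simp add: residual_def homotopy_add boundary_add)

text \<open>The residual decreases the number of active vertices of a term unless it is zero already: the
  active vertices of the new terms are among those of the given term, without the largest one.\<close>

lemma residual_mterm:
  assumes st: "res_term p s t" and card: "card (active s t) \<le> Suc n"
  shows "residual (mterm s t c) \<in> supported (\<lambda>s t. res_term p s t \<and> card (active s t) \<le> n)"
proof -
  obtain I \<sigma> where s: "s = (cov I, \<sigma>)" and I: "indep I" "\<sigma> \<subseteq> I" and p: "card \<sigma> = p" and fin: "finite \<sigma>"
    and t: "Poly_Mapping.keys t \<subseteq> VW" using st by (rule res_termE)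
  let ?A = "active (cov I, \<sigma>) t"
  have AI: "?A \<subseteq> I" by (rule active_subset[OF I])
  have finA: "finite ?A" using AI indep_finite[OF I(1)] finite_subset by blast
  show ?thesis
  proof (cases "?A = {}")
    case True
    then have "\<sigma> = {}" by (auto simp: active_def)
    then have "residual (mterm s t c) = mterm s t c"
      using True I by (simp add: residual_def s homotopy_mterm_no_active boundary_mterm boundary_zero homotopy_zero)
    moreover have "card (active s t) \<le> n" using True s by simp
    ultimately show ?thesis using st by (auto intro: supported_mterm)
  next
    case False
    have "?A \<subseteq> V" using AI I unfolding indep_def by blast
    then obtain m where m: "is_top ?A m" using False obtain_top by metis
    have mA: "m \<in> ?A" using m unfolding is_top_def by blast
    have mI: "m \<in> I" "m \<in> V" using mA AI I unfolding indep_def by auto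
    have I': "indep (I - {m})" using I indep_subset by blast
    have card': "card B \<le> n" if "B \<subseteq> ?A - {m}" for B
    proof -
      have "card B \<le> card (?A - {m})" using that finA by (intro card_mono) auto
      also have "\<dots> \<le> n" using card s mA finA by simp
      finally show ?thesis .
    qed
    show ?thesis
    proof (cases "m \<in> \<sigma>")
      case False
      let ?t = "Poly_Mapping.single (Inr (bl m)) 1 + (t - Poly_Mapping.single (Inl m) 1)"
      have "residual (mterm s t c) = mterm (cov (I - {m}), \<sigma>) ?t c"
        unfolding residual_def s homotopy_identity_not_in[OF I m False] by simp
      moreover have "mterm (cov (I - {m}), \<sigma>) ?t c \<in> supported (\<lambda>s t. res_term p s t \<and> card (active s t) \<le> n)"
      proof (intro supported_mterm conjI res_termI card' keys_single_add)
        show "Poly_Mapping.keys (t - Poly_Mapping.single (Inl m) 1) \<subseteq> VW"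
          using t keys_diff_nat[of t "Poly_Mapping.single (Inl m) 1"] by blast
        show "active (cov (I - {m}), \<sigma>) ?t \<subseteq> ?A - {m}"
          using False by (auto simp: active_cov I I' lookup_add lookup_minus lookup_single)
      qed (use I I' p False Inr_VW mI in auto)
      ultimately show ?thesis by simp
    next
      case True
      let ?t = "Poly_Mapping.single (Inr (bl m)) 1 + t"
      have "residual (mterm s t c) = - homotopy (mterm (cov (I - {m}), \<sigma> - {m}) ?t c)"
        unfolding residual_def s homotopy_identity_in[OF I m True] by simp
      moreover have "homotopy (mterm (cov (I - {m}), \<sigma> - {m}) ?t c) \<in>
          supported (\<lambda>s t. res_term p s t \<and> card (active s t) \<le> n)"
      proof (rule supported_mono[OF homotopy_mterm_res])
        show "Poly_Mapping.keys ?t \<subseteq> VW" using t mI Inr_VW by (intro keys_single_add) auto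
        fix s' t' assume *: "res_term (Suc (card (\<sigma> - {m}))) s' t' \<and>
          active s' t' \<subseteq> active (cov (I - {m}), \<sigma> - {m}) ?t"
        have "Suc (card (\<sigma> - {m})) = p" using True p fin by (metis card.remove)
        moreover have "card (active s' t') \<le> n"
          using * unfolding active_front[OF I] by (intro card') blast
        ultimately show "res_term p s' t' \<and> card (active s' t') \<le> n" using * by simp
      qed (use I I' in auto)
      ultimately show ?thesis by (auto intro: supported_uminus)
    qed
  qed
qed

text \<open>By induction on the bound \<open>n\<close>, every cycle is homologous to one whose terms have no active
  vertices: for a cycle \<open>\<phi>\<close>, the residual differs from \<open>\<phi>\<close> by a boundary.\<close>

lemma cycle_homologous_inactive_bounded:
  assumes "\<phi> \<in> supported (\<lambda>s t. res_term p s t \<and> card (active s t) \<le> n)" "boundary Ws \<phi> = 0"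
  shows "\<exists>\<psi>\<in>supported (res_term (Suc p)).
    \<phi> - boundary Ws \<psi> \<in> supported (\<lambda>s t. res_term p s t \<and> card (active s t) = 0)"
  using assms
proof (induction n arbitrary: \<phi>)
  case 0
  then show ?case by (intro bexI[of _ 0]) (auto simp: boundary_zero)
next
  case (Suc n)
  have \<phi>: "\<phi> \<in> supported (res_term p)" using Suc.prems(1) by (rule supported_mono) simp
  let ?h = "homotopy \<phi>"
  have h: "?h \<in> supported (res_term (Suc p))" using \<phi> by (rule homotopy_res)
  have "residual \<phi> = \<phi> - boundary Ws ?h"
    using Suc.prems(2) by (simp add: residual_def homotopy_zero)
  moreover have "residual \<phi> \<in> supported (\<lambda>s t. res_term p s t \<and> card (active s t) \<le> n)"
    using Suc.prems(1)
  proof (induction rule: supported_induct)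
    case zero
    then show ?case by (simp add: residual_def homotopy_zero boundary_zero)
  qed (auto simp: residual_add residual_mterm supported_add)
  moreover have "boundary Ws (\<phi> - boundary Ws ?h) = 0"
    using Suc.prems(2) boundary_boundary[OF h] by (simp add: boundary_diff)
  ultimately obtain \<psi> where \<psi>: "\<psi> \<in> supported (res_term (Suc p))"
    "\<phi> - boundary Ws ?h - boundary Ws \<psi> \<in> supported (\<lambda>s t. res_term p s t \<and> card (active s t) = 0)"
    using Suc.IH[of "\<phi> - boundary Ws ?h"] by auto
  then show ?case
    by (intro bexI[of _ "?h + \<psi>"]) (auto simp: boundary_add algebra_simps h supported_add)
qed

lemma active_subset_V: "res_term p s t \<Longrightarrow> active s t \<subseteq> V"
  using active_subset unfolding indep_def by (elim res_termE) (auto simp: indep_def active_def)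

lemma cycle_homologous_inactive:
  assumes "\<phi> \<in> supported (res_term p)" "boundary Ws \<phi> = 0"
  shows "\<exists>\<psi>\<in>supported (res_term (Suc p)).
    \<phi> - boundary Ws \<psi> \<in> supported (\<lambda>s t. res_term p s t \<and> active s t = {})"
proof -
  have "\<phi> \<in> supported (\<lambda>s t. res_term p s t \<and> card (active s t) \<le> card V)"
    using assms(1) by (rule supported_mono) (auto intro: card_mono finite_V dest: active_subset_V)
  then obtain \<psi> where "\<psi> \<in> supported (res_term (Suc p))"
    "\<phi> - boundary Ws \<psi> \<in> supported (\<lambda>s t. res_term p s t \<and> card (active s t) = 0)"
    using cycle_homologous_inactive_bounded assms(2) by blast
  moreover have "finite (active s t)" if "res_term p s t" for s t
    using active_subset_V[OF that] finite_V finite_subset by blast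
  ultimately show ?thesis by (auto elim!: bexI[rotated] supported_mono)
qed

lemma cycle_is_boundary:
  assumes "\<phi> \<in> supported (res_term (Suc p))" "boundary Ws \<phi> = 0"
  shows "\<exists>\<psi>\<in>supported (res_term (Suc (Suc p))). \<phi> = boundary Ws \<psi>"
proof -
  obtain \<psi> where \<psi>: "\<psi> \<in> supported (res_term (Suc (Suc p)))"
    "\<phi> - boundary Ws \<psi> \<in> supported (\<lambda>s t. res_term (Suc p) s t \<and> active s t = {})"
    using cycle_homologous_inactive assms by blast
  \<comment> \<open>all elements of \<open>\<sigma>\<close> are active, and \<open>\<sigma>\<close> has \<open>Suc p\<close> of them\<close>
  have "\<not> (res_term (Suc p) s t \<and> active s t = {})" for s t
    by (auto elim!: res_termE simp: active_def)
  then have "\<phi> - boundary Ws \<psi> = 0"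
    using \<psi>(2) unfolding supported_iff_coeff
    by (intro poly_mapping_eqI) (metis lookup_zero)
  then show ?thesis using \<psi>(1) by auto
qed

end

section \<open>The augmentation onto the cover ideal\<close>

lemma augmentation_eq_additive_ext:
  "augmentation = additive_ext (\<lambda>s a. a * monom_of (fst s))"
  unfolding augmentation_def additive_ext_def fun_eq_iff by (simp add: case_prod_beta)

lemma augmentation_add: "augmentation (\<phi> + \<psi>) = augmentation \<phi> + augmentation \<psi>"
  unfolding augmentation_eq_additive_ext by (rule additive_ext_add) (simp_all add: distrib_right)

lemma augmentation_scale: "augmentation (scale c \<phi>) = c * augmentation \<phi>"
  unfolding augmentation_eq_additive_ext
  by (rule additive_ext_scale) (simp_all add: mult.assoc distrib_left)

lemmas augmentation_diff = additive_diff[of augmentation, OF augmentation_add]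
lemmas augmentation_uminus = additive_uminus[of augmentation, OF augmentation_add]
lemmas augmentation_zero = additive_zero[of augmentation, OF augmentation_add]

lemma augmentation_mterm: "augmentation (mterm (C, \<sigma>) t c) = Poly_Mapping.single (t + mdeg_of C) c"
  unfolding augmentation_eq_additive_ext mterm_def
  by (simp add: additive_ext_single monom_of_eq_single mult_single)

lemma ideal_cover_ideal:
  assumes "finite U"
  shows "ideal (cover_ideal U F) (poly_ring U)"
proof -
  interpret cring "poly_ring U" by (rule cring_poly_ring)
  have "{monom_of C | C. vertex_cover U F C} \<subseteq> carrier (poly_ring U)"
    using assms finite_subset by (auto simp: vertex_cover_def intro: monom_of_closed)
  then show ?thesis unfolding cover_ideal_def by (rule genideal_ideal)
qed

context clique_whiskering
begin

abbreviation "R \<equiv> (poly_ring VW :: ('v + nat, 'k::field) mpoly ring)"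
abbreviation "J \<equiv> (cover_ideal VW EW :: ('v + nat, 'k::field) mpoly set)"

lemma J_closed:
  shows "0 \<in> J" and "f \<in> J \<Longrightarrow> g \<in> J \<Longrightarrow> f + g \<in> J"
    and "f \<in> J \<Longrightarrow> c \<in> carrier R \<Longrightarrow> c * f \<in> J"
proof -
  interpret ideal J R by (rule ideal_cover_ideal[OF finite_VW])
  show "0 \<in> J" using additive_subgroup.zero_closed[OF is_additive_subgroup] by simp
  show "f \<in> J \<Longrightarrow> g \<in> J \<Longrightarrow> f + g \<in> J"
    using additive_subgroup.a_closed[OF is_additive_subgroup, of f g] by simp
  show "f \<in> J \<Longrightarrow> c \<in> carrier R \<Longrightarrow> c * f \<in> J" using I_l_closed[of f c] by simp
qed

lemma monom_of_cover_in_J: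
  assumes "vertex_cover VW EW C"
  shows "monom_of C \<in> J"
proof -
  interpret cring R by (rule cring_poly_ring)
  have "{monom_of C | C. vertex_cover VW EW C} \<subseteq> carrier R"
    using finite_VW finite_subset by (auto simp: vertex_cover_def intro: monom_of_closed)
  then show ?thesis
    unfolding cover_ideal_def using assms by (intro subsetD[OF genideal_self]) auto
qed

lemma augmentation_in_J:
  assumes "\<phi> \<in> supported (res_term 0)"
  shows "augmentation \<phi> \<in> J"
  using assms
proof (induction rule: supported_induct)
  case (mterm s t c)
  then obtain I \<sigma> where s: "s = (cov I, \<sigma>)" "indep I" and t: "Poly_Mapping.keys t \<subseteq> VW"
    by (rule res_termE)
  have "Poly_Mapping.single t c \<in> carrier R" using t by (simp add: carrier_poly_ring_iff)
  then have "Poly_Mapping.single t c * monom_of (cov I) \<in> J"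
    using monom_of_cover_in_J[OF vertex_cover_cov[OF s(2)]] by (intro J_closed)
  then show ?case by (simp add: s augmentation_mterm monom_of_eq_single mult_single)
qed (auto simp: augmentation_zero augmentation_add J_closed)

lemma single_symbol_res:
  assumes "indep I" "f \<in> carrier R"
  shows "Poly_Mapping.single (cov I, {}) f \<in> supported (res_term 0)"
  unfolding single_eq_sum_mterm
  by (intro supported_sum supported_mterm res_termI) (use assms in \<open>auto simp: carrier_poly_ring_iff\<close>)

lemma scale_res:
  "c \<in> carrier R \<Longrightarrow> \<phi> \<in> supported (res_term p) \<Longrightarrow> scale c \<phi> \<in> supported (res_term p)"
  using scale_closed[of c VW \<phi> "symbols V E Ws p"]
  by (simp add: carrier_resolution_module[unfolded resolution_module_def])

text \<open>The image is an ideal, and it contains the generators because every vertex cover contains a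
  minimal one.\<close>

lemma augmentation_image:
  "augmentation ` supported (res_term 0) = (J :: ('v + nat, 'k::field) mpoly set)"
proof
  show "augmentation ` supported (res_term 0) \<subseteq> J" using augmentation_in_J by blast
  interpret cring R by (rule cring_poly_ring)
  let ?im = "augmentation ` supported (res_term 0) :: ('v + nat, 'k) mpoly set"
  have sub: "?im \<subseteq> carrier R"
    using augmentation_in_J ideal.Icarr[OF ideal_cover_ideal[OF finite_VW]] by blast
  have "ideal ?im R"
  proof (rule idealI)
    show "ring R" by (rule ring_axioms)
    show "subgroup ?im (add_monoid R)"
    proof
      show "?im \<subseteq> carrier (add_monoid R)" using sub by simp
      show "\<one>\<^bsub>add_monoid R\<^esub> \<in> ?im"
        using imageI[OF supported_zero, of augmentation "res_term 0"] by (simp add: augmentation_zero)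
      fix f g :: "('v + nat, 'k) mpoly" assume "f \<in> ?im"
      then obtain \<phi> where \<phi>: "\<phi> \<in> supported (res_term 0)" "f = augmentation \<phi>" by blast
      then have "f \<in> carrier R" using sub by blast
      then have "\<ominus>\<^bsub>R\<^esub> f = - f"
        using minus_equality[of "- f" f] poly_ring_uminus[of f VW] by simp
      then show "inv\<^bsub>add_monoid R\<^esub> f \<in> ?im"
        using \<phi> by (auto simp: a_inv_def augmentation_uminus intro!: image_eqI[of _ _ "- \<phi>"] supported_uminus)
      assume "g \<in> ?im"
      then show "f \<otimes>\<^bsub>add_monoid R\<^esub> g \<in> ?im"
        using \<phi> by (auto simp flip: augmentation_add intro: supported_add)
    qed
    fix f c :: "('v + nat, 'k) mpoly" assume "f \<in> ?im" and c: "c \<in> carrier R"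
    then show "c \<otimes>\<^bsub>R\<^esub> f \<in> ?im" "f \<otimes>\<^bsub>R\<^esub> c \<in> ?im"
      by (auto simp: mult.commute[of _ c] simp flip: augmentation_scale intro: scale_res)
  qed
  moreover have "monom_of C \<in> ?im" if C: "vertex_cover VW EW C" for C
  proof -
    let ?I = "{x \<in> V. Inl x \<notin> C}"
    have I: "indep ?I" "cov ?I \<subseteq> C" using vertex_cover_contains_cov[OF C] by auto
    have "C \<subseteq> VW" and fin: "finite C" using C finite_VW finite_subset unfolding vertex_cover_def by auto
    then have f: "monom_of (C - cov ?I) \<in> carrier R" by (intro monom_of_closed) auto
    have "monom_of C = monom_of (C - cov ?I) * monom_of (cov ?I)"
      unfolding monom_of_def using prod.subset_diff[OF I(2) fin] by blast
    also have "\<dots> = augmentation (Poly_Mapping.single (cov ?I, {}) (monom_of (C - cov ?I)))"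
      unfolding augmentation_eq_additive_ext by (simp add: additive_ext_single)
    finally show ?thesis using single_symbol_res[OF I(1) f] by blast
  qed
  ultimately show "J \<subseteq> ?im"
    unfolding cover_ideal_def by (intro genideal_minimal) auto
qed

lemma augmentation_boundary:
  assumes "\<phi> \<in> supported (res_term 1)"
  shows "augmentation (boundary Ws \<phi>) = 0"
  using assms
proof (induction rule: supported_induct)
  case (mterm s t c)
  then obtain I \<sigma> where s: "s = (cov I, \<sigma>)" "indep I" "\<sigma> \<subseteq> I" "card \<sigma> = 1"
    by (rule res_termE)
  then obtain x where x: "\<sigma> = {x}" by (auto simp: card_1_singleton_iff)
  have "Poly_Mapping.single (Inr (bl x)) 1 + t + mdeg_of (cov (I - {x})) =
      Poly_Mapping.single (Inl x) 1 + t + mdeg_of (cov I)"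
    using mdeg_of_cov_remove[of I x] s x by (metis (no_types, lifting) add.assoc add.commute insert_subset)
  then show ?case
    using s x by (simp add: boundary_mterm bterm_def augmentation_diff augmentation_mterm del: One_nat_def)
qed (auto simp: boundary_zero boundary_add augmentation_zero augmentation_add)

text \<open>The degree of a term without active vertices determines the term: \<open>I\<close> consists of the vertices of \<open>G\<close>
  that do not divide it.\<close>

lemma inactive_term_unique:
  assumes "res_term 0 s t" "active s t = {}" "res_term 0 s' t'" "active s' t' = {}"
    and "t + mdeg_of (fst s) = t' + mdeg_of (fst s')"
  shows "s = s' \<and> t = t'"
proof -
  obtain I where s: "s = (cov I, {})" "indep I" using assms(1) by (auto elim!: res_termE)
  obtain I' where s': "s' = (cov I', {})" "indep I'" using assms(3) by (auto elim!: res_termE)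
  have char: "x \<in> L \<longleftrightarrow> Poly_Mapping.lookup (u + mdeg_of (cov L)) (Inl x) = 0"
    if "indep L" "active (cov L, {}) u = {}" "x \<in> V" for L u x
    using that by (auto simp: active_cov lookup_add lookup_mdeg_of finite_cov Inl_in_cov)
  have "x \<in> I \<longleftrightarrow> x \<in> I'" if "x \<in> V" for x
    using char[of I t x] char[of I' t' x] that assms s s' by simp
  then have "I = I'" using s(2) s'(2) unfolding indep_def by blast
  then show ?thesis using assms(5) s s' by simp
qed

lemma augmentation_inactive_inj:
  assumes "\<phi> \<in> supported (\<lambda>s t. res_term 0 s t \<and> active s t = {})" "augmentation \<phi> = 0"
  shows "\<phi> = 0"
proof -
  \<comment> \<open>distinct terms go to distinct monomials, so the coefficients of \<open>\<phi>\<close> can be read off\<close>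
  have coeff: "Poly_Mapping.lookup (augmentation \<phi>) (t + mdeg_of (fst s)) =
      Poly_Mapping.lookup (Poly_Mapping.lookup \<phi> s) t"
    if "res_term 0 s t" "active s t = {}" for s t
    using assms(1)
  proof (induction rule: supported_induct)
    case (mterm s' t' c)
    then have "t + mdeg_of (fst s) = t' + mdeg_of (fst s') \<longleftrightarrow> s = s' \<and> t = t'"
      using inactive_term_unique[of s t s' t'] that by blast
    then show ?case
      using augmentation_mterm[of "fst s'" "snd s'" t' c]
      by (auto simp: coeff_mterm lookup_single when_def)
  qed (auto simp: augmentation_zero augmentation_add lookup_add)
  show ?thesis
  proof (intro poly_mapping_eqI)
    fix s t
    show "Poly_Mapping.lookup (Poly_Mapping.lookup \<phi> s) t = Poly_Mapping.lookup (Poly_Mapping.lookup 0 s) t"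
      using coeff[of s t] assms unfolding supported_iff_coeff by fastforce
  qed
qed

lemma augmentation_kernel:
  assumes "\<phi> \<in> supported (res_term 0)" "augmentation \<phi> = 0"
  shows "\<exists>\<psi>\<in>supported (res_term 1). \<phi> = boundary Ws \<psi>"
proof -
  have "boundary Ws \<phi> = 0" using assms(1)
    by (induction rule: supported_induct)
      (auto simp: boundary_zero boundary_add boundary_mterm elim!: res_termE)
  then obtain \<psi> where \<psi>: "\<psi> \<in> supported (res_term 1)"
    "\<phi> - boundary Ws \<psi> \<in> supported (\<lambda>s t. res_term 0 s t \<and> active s t = {})"
    using cycle_homologous_inactive[OF assms(1)] by auto
  moreover have "augmentation (\<phi> - boundary Ws \<psi>) = 0"
    using assms(2) augmentation_boundary[OF \<psi>(1)] by (simp add: augmentation_diff)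
  ultimately have "\<phi> - boundary Ws \<psi> = 0" using augmentation_inactive_inj by blast
  then show ?thesis using \<psi>(1) by auto
qed

section \<open>Minimality and homogeneity\<close>

text \<open>Minimality: in both summands of a face the coefficient is divisible by a variable.\<close>

lemma boundary_in_maximal_ideal_smult:
  fixes \<phi> :: "'v symb \<Rightarrow>\<^sub>0 ('v + nat, 'k::field) mpoly"
  assumes "\<phi> \<in> supported (res_term (Suc p))"
  shows "boundary Ws \<phi> \<in> ideal_smult R (graded_maximal_ideal VW) (resolution_module V E Ws p)"
proof -
  let ?M = "resolution_module V E Ws p :: (('v + nat, 'k) mpoly, 'v symb \<Rightarrow>\<^sub>0 ('v + nat, 'k) mpoly) module"
  let ?m = "graded_maximal_ideal VW :: ('v + nat, 'k) mpoly set"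
  let ?gen = "{a \<odot>\<^bsub>?M\<^esub> x | a x. a \<in> ?m \<and> x \<in> carrier ?M}"
  interpret M: Module.module R ?M unfolding resolution_module_def by (rule module_free_module_on)
  have Var: "Var ` VW \<subseteq> carrier R" by (auto intro: Var_closed)
  have "ideal ?m R" unfolding graded_maximal_ideal_def by (rule M.R.genideal_ideal[OF Var])
  then have "a \<in> carrier R" if "a \<in> ?m" for a using ideal.Icarr that by metis
  then have gen: "?gen \<subseteq> carrier ?M" using M.smult_closed by auto
  have mem: "mterm s (Poly_Mapping.single v 1 + t) c \<in> M.span ?gen" if "v \<in> VW" "res_term p s t" for s v t c
  proof -
    have "Var v \<in> ?m" using that M.R.genideal_self[OF Var] unfolding graded_maximal_ideal_def by blast
    moreover have "mterm s t c \<in> carrier ?M"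
      using that by (simp add: carrier_resolution_module supported_mterm)
    ultimately have "scale (Var v) (mterm s t c) \<in> ?gen"
      by (auto simp: resolution_module_def)
    then show ?thesis using M.in_own_span[OF gen] by (auto simp: scale_Var_mterm)
  qed
  have sub: "submodule R (M.span ?gen) ?M" by (rule M.span_is_submodule[OF gen])
  have add: "a + b \<in> M.span ?gen" if "a \<in> M.span ?gen" "b \<in> M.span ?gen" for a b
    using submodule.m_closed[OF sub that] by (simp add: resolution_module_def)
  have zero: "0 \<in> M.span ?gen"
    using submodule.zero_closed[OF sub] by (simp add: resolution_module_def)
  have sum: "sum f A \<in> M.span ?gen" if "\<And>a. a \<in> A \<Longrightarrow> f a \<in> M.span ?gen" for f and A :: "'v set"
    using that by (induction A rule: infinite_finite_induct) (auto intro: add zero)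
  have "boundary Ws \<phi> \<in> M.span ?gen"
    using assms
  proof (induction rule: supported_induct)
    case (mterm s t c)
    then obtain I \<sigma> where s: "s = (cov I, \<sigma>)" "indep I" "\<sigma> \<subseteq> I" "card \<sigma> = Suc p" "finite \<sigma>"
      and t: "Poly_Mapping.keys t \<subseteq> VW" by (rule res_termE)
    have "bterm I \<sigma> t k x \<in> M.span ?gen" if x: "x \<in> \<sigma>" for k :: 'k and x
    proof -
      have "x \<in> V" "indep (I - {x})" using x s indep_subset[of I] unfolding indep_def by blast+
      moreover have "bterm I \<sigma> t k x =
          mterm (cov (I - {x}), \<sigma> - {x}) (Poly_Mapping.single (Inr (bl x)) 1 + t) k +
          mterm (cov I, \<sigma> - {x}) (Poly_Mapping.single (Inl x) 1 + t) (- k)"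
        by (simp add: bterm_def mterm_uminus)
      ultimately show ?thesis
        using s t x Inl_VW Inr_VW by (auto intro!: add mem res_termI simp del: One_nat_def)
    qed
    then show ?case using s by (auto simp: boundary_mterm intro: sum)
  qed (auto simp: boundary_zero boundary_add add zero)
  then show ?thesis unfolding ideal_smult_def .
qed

lemma resolution_component_eq:
  "resolution_component V E Ws p \<mu> = supported (\<lambda>s t. res_term p s t \<and> t + symbol_mdeg s = \<mu>)"
  by (simp add: resolution_component_def free_module_component_eq res_term_def)

lemma boundary_homogeneous:
  "homogeneous_map (resolution_component V E Ws (Suc p)) (resolution_component V E Ws p)
    (boundary Ws :: ('v symb \<Rightarrow>\<^sub>0 ('v + nat, 'k::field) mpoly) \<Rightarrow> _)"
proof -
  have "boundary Ws \<phi> \<in> supported (\<lambda>s t. res_term p s t \<and> t + symbol_mdeg s = \<mu>)"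
    if "\<phi> \<in> supported (\<lambda>s t. res_term (Suc p) s t \<and> t + symbol_mdeg s = \<mu>)"
    for \<phi> :: "'v symb \<Rightarrow>\<^sub>0 ('v + nat, 'k) mpoly" and \<mu>
    using that
  proof (rule boundary_in_supported)
    fix s t and c :: 'k assume *: "res_term (Suc p) s t \<and> t + symbol_mdeg s = \<mu>"
    then obtain I \<sigma> where "s = (cov I, \<sigma>)" "indep I" "\<sigma> \<subseteq> I" "card \<sigma> = Suc p" "Poly_Mapping.keys t \<subseteq> VW"
      by (auto elim!: res_termE)
    then show "boundary Ws (mterm s t c) \<in> supported (\<lambda>s t. res_term p s t \<and> t + symbol_mdeg s = \<mu>)"
      using boundary_mterm_supported[of I \<sigma> p t c] * by simp
  qed
  then show ?thesis
    unfolding homogeneous_map_def resolution_component_eq by blast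
qed

lemma augmentation_homogeneous:
  "homogeneous_map (resolution_component V E Ws 0) (ideal_component J) augmentation"
proof -
  have "Poly_Mapping.keys (augmentation \<phi>) \<subseteq> {\<mu>}"
    if "\<phi> \<in> supported (\<lambda>s t. res_term 0 s t \<and> t + symbol_mdeg s = \<mu>)"
    for \<phi> :: "'v symb \<Rightarrow>\<^sub>0 ('v + nat, 'k::field) mpoly" and \<mu>
    using that
  proof (induction rule: supported_induct)
    case (add a b)
    then show ?case using keys_add[of "augmentation a" "augmentation b"] by (auto simp: augmentation_add)
  next
    case (mterm s t c)
    then show ?case
      by (auto elim!: res_termE simp: augmentation_mterm symbol_mdeg_def mdeg_of_def split: if_splits)
  qed (simp add: augmentation_zero)
  then show ?thesis
    unfolding homogeneous_map_def resolution_component_eq ideal_component_def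
    by (auto intro!: augmentation_in_J elim: supported_mono)
qed

section \<open>The resolution\<close>

lemma mod_hom_boundary:
  "mod_hom R (resolution_module V E Ws (Suc p)) (resolution_module V E Ws p) (boundary Ws)"
proof (intro mod_hom.intro mod_hom_axioms.intro)
  show "Module.module R (resolution_module V E Ws q)" for q
    unfolding resolution_module_def by (rule module_free_module_on)
  then show "Module.module R (resolution_module V E Ws p)" .
  show "boundary Ws \<in> module_hom R (resolution_module V E Ws (Suc p)) (resolution_module V E Ws p)"
    unfolding module_hom_def carrier_resolution_module
    using boundary_res by (auto simp: resolution_module_def boundary_add boundary_scale)
qed

lemma mod_hom_augmentation:
  "mod_hom R (resolution_module V E Ws 0) (ideal_module R J) augmentation"
proof (intro mod_hom.intro mod_hom_axioms.intro)
  show "Module.module R (resolution_module V E Ws 0)"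
    unfolding resolution_module_def by (rule module_free_module_on)
  show "Module.module R (ideal_module R J)"
    by (rule ideal_module_module[OF ideal_cover_ideal[OF finite_VW]])
  show "augmentation \<in> module_hom R (resolution_module V E Ws 0) (ideal_module R J)"
    unfolding module_hom_def carrier_resolution_module
    using augmentation_in_J
    by (auto simp: resolution_module_def ideal_module_def augmentation_add augmentation_scale)
qed

lemma free_resolution_boundary:
  "free_resolution R (ideal_module R J) (resolution_module V E Ws) (\<lambda>p. boundary Ws) augmentation"
  unfolding free_resolution_def
proof (intro conjI allI)
  note hom = mod_hom_boundary and aug = mod_hom_augmentation
  note defs = mod_hom.im_def[OF hom] mod_hom.ker_def[OF hom] mod_hom.im_def[OF aug] mod_hom.ker_def[OF aug]
  show "free_module R (resolution_module V E Ws p)" for p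
    unfolding resolution_module_def by (rule free_module_free_module_on)
  show "mod_hom.im (resolution_module V E Ws 0) augmentation = carrier (ideal_module R J)"
    unfolding defs carrier_resolution_module by (simp add: augmentation_image ideal_module_def)
  show "mod_hom.im (resolution_module V E Ws 1) (boundary Ws) =
      mod_hom.ker (resolution_module V E Ws 0) (ideal_module R J) augmentation"
    unfolding One_nat_def defs carrier_resolution_module
    using augmentation_boundary augmentation_kernel boundary_res[of _ 0]
    by (auto simp: ideal_module_def image_iff)
  show "mod_hom.im (resolution_module V E Ws (Suc (Suc p))) (boundary Ws) =
      mod_hom.ker (resolution_module V E Ws (Suc p)) (resolution_module V E Ws p) (boundary Ws)" for p
    unfolding defs carrier_resolution_module
    using boundary_boundary boundary_res cycle_is_boundary
    by (auto simp: resolution_module_def image_iff)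
qed (rule mod_hom_boundary mod_hom_augmentation)+

end

theorem theorem3p10:
  fixes V :: "'v set" and E :: "'v set set" and Ws :: "'v list list"
  assumes "simple_graph V E"
    and "clique_partition V E Ws"
  defines "VW \<equiv> whiskered_vertices V Ws"
    and "J \<equiv> (cover_ideal (whiskered_vertices V Ws) (whiskered_edges E Ws)
               :: ('v + nat, 'k::field) mpoly set)"
  shows "minimal_free_resolution (poly_ring VW) (graded_maximal_ideal VW)
           (ideal_module (poly_ring VW) J)
           (resolution_module V E Ws) (\<lambda>p. boundary Ws) augmentation
       \<and> homogeneous_map (resolution_component V E Ws 0) (ideal_component J) augmentation
       \<and> (\<forall>p. homogeneous_map (resolution_component V E Ws (Suc p))
                (resolution_component V E Ws p)
                (boundary Ws :: ('v symb \<Rightarrow>\<^sub>0 ('v + nat, 'k) mpoly) \<Rightarrow> _))"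
proof -
  interpret clique_whiskering V E Ws by unfold_locales (fact assms)+
  show ?thesis
    unfolding minimal_free_resolution_def VW_def J_def
    using free_resolution_boundary augmentation_homogeneous boundary_homogeneous
    by (auto simp: mod_hom.im_def[OF mod_hom_boundary] carrier_resolution_module
        intro: boundary_in_maximal_ideal_smult)
qed

end
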